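(* Let $h\in C[0,1]$, $\varrho>0$, let $n\ge 1$ be an integer with $n\ge\frac{4\varrho+6}{\varrho}$, let $\varepsilon=\sqrt{\frac{\varrho+2}{n\varrho+2}}$ (so that $\varepsilon\le\frac12$), and let $\Psi(x)=x(1-x)$. Then for all $x\in[0,1]$, $$|H_n^{\varrho}(h;x)|\le\Psi(x)\left[\frac{2\varrho}{3(\varrho+1)}\sqrt{\frac{\varrho+2}{n\varrho+2}}\;\omega_1(h;\varepsilon)+\frac34\left(\frac{2\varrho}{\varrho+1}+\frac{2\varrho}{3(\varrho+1)}\sqrt{\frac{\varrho+2}{n\varrho+2}}+\frac{7(\varrho+3)}{6(\varrho+1)}\right)\omega_2(h;\varepsilon)\right].$$
   Context: $C[0,1]$ is the space of continuous real-valued functions on $[0,1]$ with sup norm $\|\cdot\|_\infty$. For $\varrho>0$ and an integer $n\ge 1$, the operator $U_n^{\varrho}$ on $C[0,1]$ is defined by $$U_n^{\varrho}(f,x)=f(0)(1-x)^n+f(1)x^n+\sum_{k=1}^{n-1}\left(\int_0^1\frac{t^{k\varrho-1}(1-t)^{(n-k)\varrho-1}}{B(k\varrho,(n-k)\varrho)}f(t)\,dt\right)p_{n,k}(x),$$ where $p_{n,k}(x)=\binom nk x^k(1-x)^{n-k}$ and $B(\cdot,\cdot)$ is Euler's Beta function. $C_0[0,1]:=\{f : f(x)=x(1-x)h(x),\ h\in C[0,1]\}$, with norm $\|f\|_0:=\|h\|_\infty$ for $f(x)=x(1-x)h(x)$; this is a Banach space. $U_n^{\varrho}$ maps $C_0[0,1]$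 into itself with operator norm (with respect to $\|\cdot\|_0$) strictly less than $1$, so one may define $A_n^{\varrho}:C_0[0,1]\to C_0[0,1]$ by $$A_n^{\varrho}:=\frac{\varrho}{n\varrho+1}\sum_{k=0}^{\infty}(U_n^{\varrho})^k,\qquad n\ge1,$$ the series converging in operator norm on $(C_0[0,1],\|\cdot\|_0)$. $A_\varrho:\{y\in C^2[0,1] : y(0)=y(1)=0\}\to C_0[0,1]$ is the (bijective) operator $A_\varrho y(x):=\frac{\varrho+1}{2\varrho}x(1-x)y''(x)$. For $h\in C[0,1]$ its inverse satisfies $$-A_\varrho^{-1}(\Psi h;x)=\frac{2\varrho}{\varrho+1}\left[(1-x)\int_0^x t\,h(t)\,dt+x\int_x^1(1-t)h(t)\,dt\right].$$ The linear operator $H_n^{\varrho}$ on $C[0,1]$ is defined by $$H_n^{\varrho}(h;x):=A_n^{\varrho}(\Psi h;x)-\bigl(-A_\varrho^{-1}(\Psi h;x)\bigr),\qquad h\in C[0,1],\ x\in[0,1].$$ $\omega_1$ and $\omega_2$ are the usual first and second order moduli of continuity on $[0,1]$: $\omega_1(h;\delta)=\sup\{|h(x)-h(y)| : x,y\in[0,1],\ |x-y|\le\delta\}$ and $\omega_2(h;\delta)=\sup\{|h(x+s)-2h(x)+h(x-s)| : 0\le s\le\delta,\ x\pm s\in[0,1]\}$. *)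

theory Defs
  imports "HOL-Analysis.Analysis" "HOL-Library.FuncSet"
begin

text \<open>
  Functions on $[0,1]$ are modelled as functions of type \<^typ>\<open>real \<Rightarrow> real\<close> that are extensional on
  \<open>{0..1}\<close> (i.e. equal to \<^term>\<open>undefined\<close> elsewhere), so that equality of elements of the
  function spaces below is equality on $[0,1]$.
\<close>

definition C01 :: "(real \<Rightarrow> real) set" where
  "C01 = {f \<in> extensional {0..1}. continuous_on {0..1} f}"

definition sup_norm :: "(real \<Rightarrow> real) \<Rightarrow> real" where
  "sup_norm f = (SUP x\<in>{0..1}. \<bar>f x\<bar>)"

definition Psi :: "real \<Rightarrow> real" where
  "Psi x = x * (1 - x)"

definition times_Psi :: "(real \<Rightarrow> real) \<Rightarrow> real \<Rightarrow> real" where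
  "times_Psi h = (\<lambda>x\<in>{0..1}. Psi x * h x)"

definition C0 :: "(real \<Rightarrow> real) set" where
  "C0 = times_Psi ` C01"

text \<open>The quotient \<open>h\<close> is unique: it is determined on the open interval, hence by continuity on
  $[0,1]$.\<close>
definition norm0 :: "(real \<Rightarrow> real) \<Rightarrow> real" where
  "norm0 f = sup_norm (THE h. h \<in> C01 \<and> f = times_Psi h)"

text \<open>\<^const>\<open>Bernstein\<close> \<open>n k x\<close> is $p_{n,k}(x)$.\<close>
definition U :: "real \<Rightarrow> nat \<Rightarrow> (real \<Rightarrow> real) \<Rightarrow> real \<Rightarrow> real" where
  "U \<rho> n f = (\<lambda>x\<in>{0..1}.
     f 0 * (1 - x) ^ n + f 1 * x ^ n +
     (\<Sum>k = 1..n - 1.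
        integral {0..1}
          (\<lambda>t. t powr (real k * \<rho> - 1) * (1 - t) powr (real (n - k) * \<rho> - 1)
               / Beta (real k * \<rho>) (real (n - k) * \<rho>) * f t)
        * Bernstein n k x))"

definition linear_ops_C0 :: "((real \<Rightarrow> real) \<Rightarrow> real \<Rightarrow> real) set" where
  "linear_ops_C0 = {T \<in> C0 \<rightarrow>\<^sub>E C0. \<forall>f\<in>C0. \<forall>g\<in>C0. \<forall>a b.
     T (\<lambda>x\<in>{0..1}. a * f x + b * g x) = (\<lambda>x\<in>{0..1}. a * T f x + b * T g x)}"

text \<open>The operator norm takes extended values, so that it is \<^term>\<open>\<infinity>\<close> for an unbounded operator.\<close>
definition op_norm0 :: "((real \<Rightarrow> real) \<Rightarrow> real \<Rightarrow> real) \<Rightarrow> ennreal" where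
  "op_norm0 T = (SUP f\<in>{f \<in> C0. norm0 f \<le> 1}. ennreal (norm0 (T f)))"

text \<open>The sum $\sum_{k=0}^\infty (U_n^\varrho)^k$, as a limit in operator norm.\<close>
definition U_power_sum :: "real \<Rightarrow> nat \<Rightarrow> (real \<Rightarrow> real) \<Rightarrow> real \<Rightarrow> real" where
  "U_power_sum \<rho> n = (THE S. S \<in> linear_ops_C0 \<and>
     (\<lambda>N. op_norm0 (\<lambda>f. \<lambda>x\<in>{0..1}. (\<Sum>k<N. (U \<rho> n ^^ k) f x) - S f x)) \<longlonglongrightarrow> 0)"

definition A_n :: "real \<Rightarrow> nat \<Rightarrow> (real \<Rightarrow> real) \<Rightarrow> real \<Rightarrow> real" where
  "A_n \<rho> n f = (\<lambda>x\<in>{0..1}. \<rho> / (real n * \<rho> + 1) * U_power_sum \<rho> n f x)"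

text \<open>Derivative on $[0,1]$, one-sided at the end points.\<close>
definition deriv01 :: "(real \<Rightarrow> real) \<Rightarrow> real \<Rightarrow> real" where
  "deriv01 f x = vector_derivative f (at x within {0..1})"

definition C2_01 :: "(real \<Rightarrow> real) set" where
  "C2_01 = {y \<in> extensional {0..1}. y differentiable_on {0..1} \<and>
     deriv01 y differentiable_on {0..1} \<and> continuous_on {0..1} (deriv01 (deriv01 y))}"

definition dom_A :: "(real \<Rightarrow> real) set" where
  "dom_A = {y \<in> C2_01. y 0 = 0 \<and> y 1 = 0}"

definition A :: "real \<Rightarrow> (real \<Rightarrow> real) \<Rightarrow> real \<Rightarrow> real" where
  "A \<rho> y = (\<lambda>x\<in>{0..1}. (\<rho> + 1) / (2 * \<rho>) * (x * (1 - x)) * deriv01 (deriv01 y) x)"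

definition A_inv :: "real \<Rightarrow> (real \<Rightarrow> real) \<Rightarrow> real \<Rightarrow> real" where
  "A_inv \<rho> = inv_into dom_A (A \<rho>)"

definition H :: "real \<Rightarrow> nat \<Rightarrow> (real \<Rightarrow> real) \<Rightarrow> real \<Rightarrow> real" where
  "H \<rho> n h = (\<lambda>x\<in>{0..1}. A_n \<rho> n (times_Psi h) x - (- A_inv \<rho> (times_Psi h) x))"

definition omega1 :: "(real \<Rightarrow> real) \<Rightarrow> real \<Rightarrow> real" where
  "omega1 h \<delta> = Sup {\<bar>h x - h y\<bar> | x y. x \<in> {0..1} \<and> y \<in> {0..1} \<and> \<bar>x - y\<bar> \<le> \<delta>}"

definition omega2 :: "(real \<Rightarrow> real) \<Rightarrow> real \<Rightarrow> real" where
  "omega2 h \<delta> = Sup {\<bar>h (x + s) - 2 * h x + h (x - s)\<bar> | x s.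
     0 \<le> s \<and> s \<le> \<delta> \<and> x + s \<in> {0..1} \<and> x - s \<in> {0..1}}"

end

theory Submission
  imports Defs
begin

text \<open>
  Put \<open>y = A_inv \<rho> (\<Psi> h)\<close>, so that \<open>y'' = 2\<rho>/(\<rho>+1) h\<close>. Since \<open>(I - U) \<Sum>U\<^sup>k = I\<close>, the error \<open>H h\<close>
  equals \<open>A_n\<close> applied to the Voronovskaja remainder \<open>\<Psi> h - (n\<rho>+1)/\<rho> (U y - y)\<close>, and \<open>A_n\<close> maps
  functions bounded by \<open>K \<Psi>\<close> to functions bounded by \<open>\<rho>/(\<rho>+1) K \<Psi>\<close> because
  \<open>U \<Psi> = (n-1)\<rho>/(n\<rho>+1) \<Psi>\<close>. Instead of smoothing \<open>h\<close>, one compares it near each point \<open>x\<close> with the line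
  through \<open>(x, h x)\<close> whose slope \<open>m\<close> is a one-sided difference quotient with step \<open>\<epsilon>\<close>: then
  \<open>\<bar>m\<bar> \<le> \<omega>\<^sub>1/\<epsilon>\<close> and \<open>\<bar>h s - h x - m (s - x)\<bar> \<le> (2 + 3 ((s - x)/\<epsilon>)\<^sup>2) \<omega>\<^sub>2\<close>. Integrating twice, the remainder is
  controlled by the central moments of \<open>U\<close> of orders 2, 3 and 4, which gives the claim with the smaller
  constants \<open>\<rho> \<epsilon>/(3(\<rho>+1))\<close> at \<open>\<omega>\<^sub>1\<close> and \<open>19 \<rho>/(8(\<rho>+1))\<close> at \<open>\<omega>\<^sub>2\<close>.
\<close>

subsection \<open>Moduli of continuity and local linear approximation\<close>

text \<open>At a point p where \<open>\<bar>g\<bar>\<close> is maximal, take the second difference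
  centred at p whose step is the distance from p to the nearer end point. One outer value is zero
  and the other is at most \<open>\<bar>g p\<bar>\<close>, so 2 \<open>\<bar>g p\<bar>\<close> \<le>
  w + \<open>\<bar>g p\<bar>\<close>.\<close>

lemma second_difference_interval_bound:
  fixes g :: "real \<Rightarrow> real"
  assumes "e > 0" and cont: "continuous_on {0..e} g" and "g 0 = 0" "g e = 0"
    and sd: "\<And>c s. 0 \<le> s \<Longrightarrow> s \<le> e \<Longrightarrow> 0 \<le> c - s \<Longrightarrow> c + s \<le> e \<Longrightarrow>
      \<bar>g (c + s) - 2 * g c + g (c - s)\<bar> \<le> w"
    and "t \<in> {0..e}"
  shows "\<bar>g t\<bar> \<le> w"
proof -
  have "continuous_on {0..e} (\<lambda>t. \<bar>g t\<bar>)"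
    using cont by (intro continuous_intros)
  then obtain p where p: "p \<in> {0..e}" and max: "\<And>t. t \<in> {0..e} \<Longrightarrow> \<bar>g t\<bar> \<le> \<bar>g p\<bar>"
    using continuous_attains_sup[of "{0..e}" "\<lambda>t. \<bar>g t\<bar>"] \<open>e > 0\<close> by auto
  have "\<bar>g p\<bar> \<le> w"
  proof (cases "p \<le> e / 2")
    case True
    then show ?thesis
      using sd[of p p] max[of "p + p"] p \<open>g 0 = 0\<close> by auto
  next
    case False
    then have "\<bar>g e - 2 * g p + g (p - (e - p))\<bar> \<le> w"
      using sd[of "e - p" p] p by auto
    moreover have "\<bar>g (p - (e - p))\<bar> \<le> \<bar>g p\<bar>"
      using max[of "p - (e - p)"] False p by auto
    ultimately show ?thesis
      using \<open>g e = 0\<close> by auto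
  qed
  then show ?thesis
    using max[OF \<open>t \<in> {0..e}\<close>] by linarith
qed

text \<open>The increments of \<open>g\<close> along a grid of width \<open>e\<close> change by at most \<open>w\<close> per step, so the values
  on the grid grow at most quadratically.\<close>

lemma second_difference_growth:
  fixes g :: "real \<Rightarrow> real"
  assumes "e > 0" and ab: "a \<le> 0" "e \<le> b"
    and cont: "continuous_on {a..b} g" and g0: "g 0 = 0" and ge: "g e = 0"
    and sd: "\<And>c s. 0 \<le> s \<Longrightarrow> s \<le> e \<Longrightarrow> a \<le> c - s \<Longrightarrow> c + s \<le> b \<Longrightarrow>
      \<bar>g (c + s) - 2 * g c + g (c - s)\<bar> \<le> w"
    and t: "t \<in> {a..b}"
  shows "\<bar>g t\<bar> \<le> (2 + 3 * (t / e)\<^sup>2) * w"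
proof -
  have w: "w \<ge> 0"
    using sd[of 0 0] ab g0 \<open>e > 0\<close> by auto
  have mid: "\<bar>g v\<bar> \<le> w" if "v \<in> {0..e}" for v
    by (rule second_difference_interval_bound[of e g w])
      (use assms that in \<open>auto intro: continuous_on_subset[OF cont]\<close>)
  \<comment> \<open>Reflection at 0: since \<open>g 0 = 0\<close>, the values at v and -v add up to
    at most w in modulus, and the value at v is at most w itself.\<close>
  have left: "\<bar>g (- v)\<bar> \<le> 2 * w" if "0 \<le> v" "v \<le> e" "a \<le> - v" for v
    using sd[of v 0] mid[of v] that ab g0 by auto
  \<comment> \<open>Reflection at the zero e costs w, and \<open>g (e - v)\<close> and
    \<open>g v\<close> cost w each, which gives the 3. Every further grid step adds one second
    difference, which gives the j.\<close>
  have right_inc: "\<bar>g ((real j + 1) * e + v) - g (real j * e + v)\<bar> \<le> (3 + real j) * w"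
    if "0 \<le> v" "v \<le> e" "(real j + 1) * e + v \<le> b" for j v
    using that(3)
  proof (induction j)
    case 0
    have "\<bar>g (e + v) - 2 * g e + g (e - v)\<bar> \<le> w"
      by (rule sd) (use 0 that ab in auto)
    then show ?case
      using mid[of "e - v"] mid[of v] that ge by auto
  next
    case (Suc j)
    let ?c = "(real j + 1) * e + v"
    have "\<bar>g (?c + e) - 2 * g ?c + g (?c - e)\<bar> \<le> w"
    proof (rule sd)
      have "0 \<le> real j * e + v" using that \<open>e > 0\<close> by simp
      then show "a \<le> ?c - e" using ab by (simp add: algebra_simps)
    qed (use Suc.prems \<open>e > 0\<close> in \<open>auto simp: algebra_simps\<close>)
    moreover have "\<bar>g ?c - g (real j * e + v)\<bar> \<le> (3 + real j) * w"
      by (rule Suc.IH) (use Suc.prems \<open>e > 0\<close> in \<open>auto simp: algebra_simps\<close>)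
    ultimately show ?case
      by (simp add: algebra_simps abs_le_iff)
  qed
  have right: "\<bar>g (real j * e + v)\<bar> \<le> (2 + 3 * (real j)\<^sup>2) * w"
    if "0 \<le> v" "v \<le> e" "real j * e + v \<le> b" for j v
    using that(3)
  proof (induction j)
    case 0
    then show ?case using mid[of v] that w by simp
  next
    case (Suc j)
    have "\<bar>g (real j * e + v)\<bar> \<le> (2 + 3 * (real j)\<^sup>2) * w"
      by (rule Suc.IH) (use Suc.prems \<open>e > 0\<close> in \<open>auto simp: algebra_simps\<close>)
    moreover have "\<bar>g ((real j + 1) * e + v) - g (real j * e + v)\<bar> \<le> (3 + real j) * w"
      using right_inc[of v j] Suc.prems that by (simp add: algebra_simps)
    moreover have "(2 + 3 * (real j)\<^sup>2) * w + (3 + real j) * w \<le> (2 + 3 * (real (Suc j))\<^sup>2) * w"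
      unfolding distrib_right[symmetric]
      by (rule mult_right_mono) (use w in \<open>auto simp: power2_eq_square algebra_simps\<close>)
    ultimately show ?case
      by (simp add: algebra_simps abs_le_iff)
  qed
  \<comment> \<open>The initial constant is 4 rather than 3 because \<open>g (- v)\<close> is only
    bounded by 2 w.\<close>
  have left_inc: "\<bar>g (- ((real j + 1) * e + v)) - g (- (real j * e + v))\<bar> \<le> (4 + real j) * w"
    if "0 \<le> v" "v \<le> e" "a \<le> - ((real j + 1) * e + v)" for j v
    using that(3)
  proof (induction j)
    case 0
    have "\<bar>g (e - v) - 2 * g (- v) + g (- e - v)\<bar> \<le> w"
      using sd[of e "- v"] 0 that ab \<open>e > 0\<close> by (simp add: add.commute minus_diff_commute)
    then show ?case
      using mid[of "e - v"] left[of v] that(1,2) 0 ab \<open>e > 0\<close>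
      by (auto simp: abs_le_iff)
  next
    case (Suc j)
    let ?c = "- ((real j + 1) * e + v)"
    have "\<bar>g (?c + e) - 2 * g ?c + g (?c - e)\<bar> \<le> w"
    proof (rule sd)
      have "0 \<le> real j * e + v" using that \<open>e > 0\<close> by simp
      then show "?c + e \<le> b" using ab \<open>e > 0\<close> by (simp add: algebra_simps)
    qed (use Suc.prems \<open>e > 0\<close> in \<open>auto simp: algebra_simps\<close>)
    moreover have "\<bar>g ?c - g (- (real j * e + v))\<bar> \<le> (4 + real j) * w"
      by (rule Suc.IH) (use Suc.prems \<open>e > 0\<close> in \<open>auto simp: algebra_simps\<close>)
    ultimately show ?case
      by (simp add: algebra_simps abs_le_iff)
  qed
  have left_all: "\<bar>g (- (real j * e + v))\<bar> \<le> (2 + 3 * (real j)\<^sup>2) * w"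
    if "0 \<le> v" "v \<le> e" "a \<le> - (real j * e + v)" for j v
    using that(3)
  proof (induction j)
    case 0
    then show ?case using left[of v] that w by simp
  next
    case (Suc j)
    \<comment> \<open>In the first cell the increment bound would give 2 + 4 = 6, one more than the
      required 5. The second difference centred at -e with step v gives 5 directly: 1 for itself, 2
      for the doubled value at -e, which is at most w, and 2 for \<open>g (- (e - v))\<close>. From
      j = 1 on the increments suffice.\<close>
    show ?case
    proof (cases "j = 0")
      case True
      have "\<bar>g (- e + v) - 2 * g (- e) + g (- e - v)\<bar> \<le> w"
        by (rule sd) (use True Suc that ab in auto)
      moreover have "\<bar>g (0 + e) - 2 * g 0 + g (0 - e)\<bar> \<le> w"
        by (rule sd) (use True Suc that ab \<open>e > 0\<close> in auto)
      moreover have "\<bar>g (- (e - v))\<bar> \<le> 2 * w"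
        by (rule left) (use True Suc that ab \<open>e > 0\<close> in auto)
      ultimately show ?thesis
        using True g0 ge by (simp add: algebra_simps abs_le_iff)
    next
      case False
      have "\<bar>g (- (real j * e + v))\<bar> \<le> (2 + 3 * (real j)\<^sup>2) * w"
        by (rule Suc.IH) (use Suc.prems \<open>e > 0\<close> in \<open>auto simp: algebra_simps\<close>)
      moreover have "\<bar>g (- ((real j + 1) * e + v)) - g (- (real j * e + v))\<bar> \<le> (4 + real j) * w"
        using left_inc[of v j] Suc.prems that by (simp add: algebra_simps)
      moreover have "(2 + 3 * (real j)\<^sup>2) * w + (4 + real j) * w \<le> (2 + 3 * (real (Suc j))\<^sup>2) * w"
        unfolding distrib_right[symmetric]
        by (rule mult_right_mono) (use w False in \<open>auto simp: power2_eq_square algebra_simps\<close>)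
      ultimately show ?thesis
        by (simp add: algebra_simps abs_le_iff)
    qed
  qed
  define j where "j = nat \<lfloor>\<bar>t\<bar> / e\<rfloor>"
  define v where "v = \<bar>t\<bar> - real j * e"
  have j: "real j \<le> \<bar>t\<bar> / e" "\<bar>t\<bar> / e < real j + 1"
    unfolding j_def using \<open>e > 0\<close> by (auto simp: floor_le_iff)
  then have v: "0 \<le> v" "v \<le> e"
    unfolding v_def using \<open>e > 0\<close> by (auto simp: field_simps)
  have "\<bar>g t\<bar> \<le> (2 + 3 * (real j)\<^sup>2) * w"
  proof (cases "t \<ge> 0")
    case True
    then have "t = real j * e + v" by (simp add: v_def)
    then show ?thesis using right[of v j] v t by auto
  next
    case False
    then have "t = - (real j * e + v)" by (simp add: v_def)
    then show ?thesis using left_all[of v j] v t by auto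
  qed
  also have "\<dots> \<le> (2 + 3 * (t / e)\<^sup>2) * w"
  proof -
    have "(real j)\<^sup>2 \<le> (\<bar>t\<bar> / e)\<^sup>2" using j by (intro power_mono) auto
    then show ?thesis using w by (intro mult_right_mono) (auto simp: power_divide)
  qed
  finally show ?thesis .
qed

text \<open>A real \<open>Sup\<close> bounds the elements of its set only if that set is bounded
  above; boundedness of h on the compact interval supplies this.\<close>

lemma
  assumes "continuous_on {0..1} h"
  shows omega1_ge: "x \<in> {0..1} \<Longrightarrow> y \<in> {0..1} \<Longrightarrow> \<bar>x - y\<bar> \<le> \<delta> \<Longrightarrow> \<bar>h x - h y\<bar> \<le> omega1 h \<delta>"
    and omega2_ge: "0 \<le> s \<Longrightarrow> s \<le> \<delta> \<Longrightarrow> x + s \<in> {0..1} \<Longrightarrow> x - s \<in> {0..1} \<Longrightarrow>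
      \<bar>h (x + s) - 2 * h x + h (x - s)\<bar> \<le> omega2 h \<delta>"
proof -
  have "bounded (h ` {0..1})"
    using assms compact_Icc compact_continuous_image compact_imp_bounded by blast
  then obtain B where B: "\<And>t. t \<in> {0..1} \<Longrightarrow> \<bar>h t\<bar> \<le> B"
    unfolding bounded_iff by (metis imageI real_norm_def)
  show "\<bar>h x - h y\<bar> \<le> omega1 h \<delta>" if "x \<in> {0..1}" "y \<in> {0..1}" "\<bar>x - y\<bar> \<le> \<delta>" for x y
    unfolding omega1_def
  proof (rule cSup_upper)
    show "bdd_above {\<bar>h x - h y\<bar> | x y. x \<in> {0..1} \<and> y \<in> {0..1} \<and> \<bar>x - y\<bar> \<le> \<delta>}"
    proof (rule bdd_aboveI[of _ "2 * B"], clarify)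
      fix x y :: real assume "x \<in> {0..1}" "y \<in> {0..1}"
      then show "\<bar>h x - h y\<bar> \<le> 2 * B" using B[of x] B[of y] by linarith
    qed
  qed (use that in blast)
  show "\<bar>h (x + s) - 2 * h x + h (x - s)\<bar> \<le> omega2 h \<delta>"
    if "0 \<le> s" "s \<le> \<delta>" "x + s \<in> {0..1}" "x - s \<in> {0..1}"
    unfolding omega2_def
  proof (rule cSup_upper)
    show "bdd_above {\<bar>h (x + s) - 2 * h x + h (x - s)\<bar> | x s.
      0 \<le> s \<and> s \<le> \<delta> \<and> x + s \<in> {0..1} \<and> x - s \<in> {0..1}}"
    proof (rule bdd_aboveI[of _ "4 * B"], clarify)
      fix x s :: real assume *: "0 \<le> s" "x + s \<in> {0..1}" "x - s \<in> {0..1}"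
      then have "x \<in> {0..1}" by auto
      then show "\<bar>h (x + s) - 2 * h x + h (x - s)\<bar> \<le> 4 * B"
        using B[of x] B[OF *(2)] B[OF *(3)] by linarith
    qed
  qed (use that in blast)
qed

lemma omega1_nonneg: "continuous_on {0..1} h \<Longrightarrow> 0 \<le> \<delta> \<Longrightarrow> 0 \<le> omega1 h \<delta>"
  using omega1_ge[of h 0 0 \<delta>] by simp

lemma omega2_nonneg: "continuous_on {0..1} h \<Longrightarrow> 0 \<le> \<delta> \<Longrightarrow> 0 \<le> omega2 h \<delta>"
  using omega2_ge[of h 0 \<delta> 0] by simp

text \<open>The line is the chord from x to a point at distance e in the direction of the longer
  part of [0,1]; e \<le> 1/2 keeps that point inside. Subtracting a line leaves second differences
  unchanged, so the difference has two zeros at distance e and second differences bounded by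
  \<omega>2, as \<open>second_difference_growth\<close> requires.\<close>

lemma local_linear_approximation:
  assumes h: "continuous_on {0..1} h" and e: "0 < e" "e \<le> 1 / 2" and x: "x \<in> {0..1}"
  obtains m where "\<bar>m\<bar> \<le> omega1 h e / e"
    and "\<And>s. s \<in> {0..1} \<Longrightarrow>
      \<bar>h s - h x - m * (s - x)\<bar> \<le> (2 + 3 * ((s - x) / e)\<^sup>2) * omega2 h e"
proof (cases "x \<le> 1 / 2")
  case True
  define m where "m = (h (x + e) - h x) / e"
  define g where "g t = h (x + t) - h x - m * t" for t
  have "\<bar>h (x + e) - h x\<bar> \<le> omega1 h e"
    by (rule omega1_ge) (use h e x True in auto)
  then have "\<bar>m\<bar> \<le> omega1 h e / e"
    using e by (simp add: m_def divide_right_mono)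
  moreover have "\<bar>h s - h x - m * (s - x)\<bar> \<le> (2 + 3 * ((s - x) / e)\<^sup>2) * omega2 h e"
    if s: "s \<in> {0..1}" for s
  proof -
    have "\<bar>g (s - x)\<bar> \<le> (2 + 3 * ((s - x) / e)\<^sup>2) * omega2 h e"
    proof (rule second_difference_growth[of e "- x" "1 - x"])
      show "continuous_on {- x..1 - x} g"
        unfolding g_def
        by (intro continuous_intros continuous_on_compose2[OF h]) auto
      show "\<bar>g (c + s) - 2 * g c + g (c - s)\<bar> \<le> omega2 h e"
        if "0 \<le> s" "s \<le> e" "- x \<le> c - s" "c + s \<le> 1 - x" for c s
        using omega2_ge[OF h that(1,2), of "x + c"] that
        by (simp add: g_def algebra_simps)
    qed (use e x True s in \<open>auto simp: g_def m_def\<close>)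
    then show ?thesis by (simp add: g_def)
  qed
  ultimately show thesis by (rule that)
next
  case False
  define m where "m = (h x - h (x - e)) / e"
  \<comment> \<open>Here the chord goes to the left. The reflection t to x - t moves its second zero
    to +e, so that the same growth lemma applies.\<close>
  define g where "g t = h (x - t) - h x + m * t" for t
  have "\<bar>h x - h (x - e)\<bar> \<le> omega1 h e"
    by (rule omega1_ge) (use h e x False in auto)
  then have "\<bar>m\<bar> \<le> omega1 h e / e"
    using e by (simp add: m_def divide_right_mono)
  moreover have "\<bar>h s - h x - m * (s - x)\<bar> \<le> (2 + 3 * ((s - x) / e)\<^sup>2) * omega2 h e"
    if s: "s \<in> {0..1}" for s
  proof -
    have "\<bar>g (x - s)\<bar> \<le> (2 + 3 * ((x - s) / e)\<^sup>2) * omega2 h e"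
    proof (rule second_difference_growth[of e "x - 1" x])
      show "continuous_on {x - 1..x} g"
        unfolding g_def
        by (intro continuous_intros continuous_on_compose2[OF h]) auto
      show "\<bar>g (c + s) - 2 * g c + g (c - s)\<bar> \<le> omega2 h e"
        if "0 \<le> s" "s \<le> e" "x - 1 \<le> c - s" "c + s \<le> x" for c s
        using omega2_ge[OF h that(1,2), of "x - c"] that
        by (simp add: g_def algebra_simps)
    qed (use e x False s in \<open>auto simp: g_def m_def\<close>)
    moreover have "((x - s) / e)\<^sup>2 = ((s - x) / e)\<^sup>2"
      by (simp add: power_divide power2_commute)
    ultimately show ?thesis by (simp add: g_def algebra_simps)
  qed
  ultimately show thesis by (rule that)
qed

section \<open>Taylor estimates from bounds on the second derivative\<close>

text \<open>\<open>f'\<close> increases through its zero at x, so f falls before x and rises after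
  it, with minimum \<open>f x = 0\<close>. The sign of \<open>f''\<close> is asked for in the open
  interval only, because \<Psi> vanishes at the end points and the equation for \<open>A_inv\<close>
  says nothing about the second derivative there.\<close>

lemma nonneg_of_second_derivative_nonneg:
  fixes f f' f'' :: "real \<Rightarrow> real"
  assumes f': "\<And>t. t \<in> {0..1} \<Longrightarrow> (f has_real_derivative f' t) (at t within {0..1})"
    and f'': "\<And>t. t \<in> {0..1} \<Longrightarrow> (f' has_real_derivative f'' t) (at t within {0..1})"
    and nonneg: "\<And>t. t \<in> {0<..<1} \<Longrightarrow> 0 \<le> f'' t"
    and x: "x \<in> {0..1}" "f x = 0" "f' x = 0" and t: "t \<in> {0..1}"
  shows "0 \<le> f t"
proof -
  have cont: "continuous_on {0..1} f" "continuous_on {0..1} f'"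
    using f' f'' DERIV_continuous_on by blast+
  have D: "DERIV f t :> f' t" "DERIV f' t :> f'' t" if "0 < t" "t < 1" for t
    using f'[of t] f''[of t] that at_within_Icc_at[of 0 t 1] by auto
  have mono: "f' a \<le> f' b" if "0 \<le> a" "a \<le> b" "b \<le> 1" for a b
  proof (rule DERIV_nonneg_imp_increasing_open[OF \<open>a \<le> b\<close>])
    show "\<exists>y. DERIV f' s :> y \<and> 0 \<le> y" if "a < s" "s < b" for s
      using D(2)[of s] nonneg[of s] that \<open>0 \<le> a\<close> \<open>b \<le> 1\<close> by auto
  qed (use that in \<open>auto intro: continuous_on_subset[OF cont(2)]\<close>)
  show ?thesis
  proof (cases "x \<le> t")
    case True
    have "f x \<le> f t"
    proof (rule DERIV_nonneg_imp_increasing_open[OF True])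
      fix s assume "x < s" "s < t"
      then show "\<exists>y. DERIV f s :> y \<and> 0 \<le> y"
        using D(1)[of s] mono[of x s] x t by auto
    qed (use x t in \<open>auto intro: continuous_on_subset[OF cont(1)]\<close>)
    then show ?thesis using x by simp
  next
    case False
    then have "t \<le> x" by simp
    have "f x \<le> f t"
    proof (rule DERIV_nonpos_imp_decreasing_open[OF \<open>t \<le> x\<close>])
      fix s assume "t < s" "s < x"
      then show "\<exists>y. DERIV f s :> y \<and> y \<le> 0"
        using D(1)[of s] mono[of s x] x t by auto
    qed (use x t in \<open>auto intro: continuous_on_subset[OF cont(1)]\<close>)
    then show ?thesis using x by simp
  qed
qed

text \<open>Two integrations of the bound starting from x: the constants 1/2, 1/6, 1/2, 1/12 are
  those of the double antiderivatives of 1, t - x, 1 and (t - x)^2. In place of integrals, majorant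
  plus error and majorant minus error are fed to the sign criterion; both vanish at x together with
  their first derivative.\<close>

lemma second_order_taylor_bound:
  fixes f f' f'' :: "real \<Rightarrow> real"
  assumes f': "\<And>t. t \<in> {0..1} \<Longrightarrow> (f has_real_derivative f' t) (at t within {0..1})"
    and f'': "\<And>t. t \<in> {0..1} \<Longrightarrow> (f' has_real_derivative f'' t) (at t within {0..1})"
    and bound: "\<And>t. t \<in> {0<..<1} \<Longrightarrow>
      \<bar>f'' t - p - q * (t - x)\<bar> \<le> a + b * (t - x)\<^sup>2"
    and x: "x \<in> {0..1}" and t: "t \<in> {0..1}"
  shows "\<bar>f t - f x - f' x * (t - x) - (p / 2 * (t - x)\<^sup>2 + q / 6 * (t - x) ^ 3)\<bar>
    \<le> a / 2 * (t - x)\<^sup>2 + b / 12 * (t - x) ^ 4"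
proof -
  have "0 \<le> a / 2 * (t - x)\<^sup>2 + b / 12 * (t - x) ^ 4
      + \<sigma> * (f t - f x - f' x * (t - x) - (p / 2 * (t - x)\<^sup>2 + q / 6 * (t - x) ^ 3))"
    if "\<sigma> = 1 \<or> \<sigma> = - 1" for \<sigma> :: real
  proof (rule nonneg_of_second_derivative_nonneg[where x = x and t = t and
        f = "\<lambda>t. a / 2 * (t - x)\<^sup>2 + b / 12 * (t - x) ^ 4
          + \<sigma> * (f t - f x - f' x * (t - x) - (p / 2 * (t - x)\<^sup>2 + q / 6 * (t - x) ^ 3))"
        and f' = "\<lambda>t. a * (t - x) + b / 3 * (t - x) ^ 3
          + \<sigma> * (f' t - f' x - (p * (t - x) + q / 2 * (t - x)\<^sup>2))"
        and f'' = "\<lambda>t. a + b * (t - x)\<^sup>2 + \<sigma> * (f'' t - p - q * (t - x))"], goal_cases)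
    case (1 t)
    show ?case
      by (auto intro!: derivative_eq_intros f'[OF 1] simp: field_simps power2_eq_square power3_eq_cube)
  next
    case (2 t)
    show ?case
      by (auto intro!: derivative_eq_intros f''[OF 2] simp: field_simps power2_eq_square)
  next
    case (3 t)
    then show ?case using bound[of t] that by auto
  qed (use x t in auto)
  from this[of 1] this[of "- 1"] show ?thesis by (simp add: abs_le_iff)
qed

subsection \<open>Moments of the operator\<close>

text \<open>For positive a and b this is the expectation of f under the Beta distribution with these
  parameters; \<open>U\<close> uses it with a = k\<rho> and b = (n - k)\<rho>.\<close>

definition beta_mean :: "real \<Rightarrow> real \<Rightarrow> (real \<Rightarrow> real) \<Rightarrow> real" where
  "beta_mean a b f =
    integral {0..1} (\<lambda>t. t powr (a - 1) * (1 - t) powr (b - 1) / Beta a b * f t)"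

lemma Beta_real_pos: "0 < a \<Longrightarrow> 0 < b \<Longrightarrow> 0 < Beta a (b :: real)"
  by (simp add: Beta_def)

lemma beta_density_integrable:
  fixes a b :: real and f :: "real \<Rightarrow> real"
  assumes "0 < a" "0 < b" and f: "continuous_on {0..1} f"
  shows "(\<lambda>t. t powr (a - 1) * (1 - t) powr (b - 1) / Beta a b * f t) integrable_on {0..1}"
proof -
  have "(\<lambda>t. t powr (a - 1) * (1 - t) powr (b - 1)) absolutely_integrable_on {0..1}"
    by (rule nonnegative_absolutely_integrable_1[OF integrable_Beta'[OF assms(1,2)]]) auto
  moreover have "f \<in> borel_measurable (lebesgue_on {0..1})"
    by (intro continuous_imp_measurable_on_sets_lebesgue f) auto
  moreover have "bounded (f ` {0..1})"
    using f compact_Icc compact_continuous_image compact_imp_bounded by blast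
  ultimately have "(\<lambda>t. f t * (t powr (a - 1) * (1 - t) powr (b - 1))) absolutely_integrable_on {0..1}"
    by (intro absolutely_integrable_bounded_measurable_product_real[of f]) auto
  then have "(\<lambda>t. f t * (t powr (a - 1) * (1 - t) powr (b - 1))) integrable_on {0..1}"
    using set_lebesgue_integral_eq_integral(1) by blast
  from integrable_on_mult_right[OF this, of "1 / Beta a b"] show ?thesis
    by (simp add: mult.commute)
qed

lemma beta_mean_linear:
  assumes "0 < a" "0 < b" "continuous_on {0..1} f" "continuous_on {0..1} g"
  shows "beta_mean a b (\<lambda>t. c * f t + d * g t) = c * beta_mean a b f + d * beta_mean a b g"
proof -
  let ?w = "\<lambda>t. t powr (a - 1) * (1 - t) powr (b - 1) / Beta a b"
  have "beta_mean a b (\<lambda>t. c * f t + d * g t) =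
      integral {0..1} (\<lambda>t. c * (?w t * f t) + d * (?w t * g t))"
    unfolding beta_mean_def by (rule arg_cong[of _ _ "integral _"]) (simp add: distrib_left mult_ac add_divide_distrib)
  also have "\<dots> = integral {0..1} (\<lambda>t. c * (?w t * f t)) + integral {0..1} (\<lambda>t. d * (?w t * g t))"
    by (intro integral_add integrable_on_mult_right beta_density_integrable assms)
  finally show ?thesis
    by (simp add: beta_mean_def)
qed

lemma beta_mean_mono:
  assumes "0 < a" "0 < b" "continuous_on {0..1} f" "continuous_on {0..1} g"
    and le: "\<And>t. t \<in> {0..1} \<Longrightarrow> f t \<le> g t"
  shows "beta_mean a b f \<le> beta_mean a b g"
  unfolding beta_mean_def
  by (intro integral_le beta_density_integrable assms mult_left_mono divide_nonneg_pos Beta_real_pos)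
    (auto intro: le)

text \<open>Iteration of (a + b) B(a + 1, b) = a B(a, b); the rising factorials of all moments of
  \<open>U\<close> come from here.\<close>

lemma Beta_add_nat:
  assumes "0 < a" "0 < (b :: real)"
  shows "Beta (a + real i) b = Beta a b * (pochhammer a i / pochhammer (a + b) i)"
proof (induction i)
  case (Suc i)
  have "a + real i \<notin> \<int>\<^sub>\<le>\<^sub>0"
    using assms nonpos_Ints_nonpos[of "a + real i"] by linarith
  then have "(a + real i + b) * Beta (a + real i + 1) b = (a + real i) * Beta (a + real i) b"
    by (rule Beta_plus1_left)
  then have "Beta (a + real (Suc i)) b = (a + real i) * Beta (a + real i) b / (a + b + real i)"
    using assms by (simp add: field_simps)
  then show ?case
    using Suc assms pochhammer_pos[of "a + b" i]
    by (simp add: pochhammer_Suc field_simps)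
qed simp

lemma beta_mean_power:
  assumes "0 < a" "0 < b"
  shows "beta_mean a b (\<lambda>t. t ^ i) = pochhammer a i / pochhammer (a + b) i"
proof -
  have "t powr (a - 1) * (1 - t) powr (b - 1) / Beta a b * t ^ i =
      1 / Beta a b * (t powr (a + real i - 1) * (1 - t) powr (b - 1))" if "t \<in> {0..1}" for t
  \<comment> \<open>The addition rule for exponents needs t \<noteq> 0. At t = 0 both sides are zero
    since \<open>0 powr _ = 0\<close>, whatever the exponent.\<close>
  proof (cases "t = 0")
    case False
    then have "t powr (a + real i - 1) = t powr (a - 1) * t ^ i"
      using that by (simp add: powr_realpow[symmetric] powr_add[symmetric] algebra_simps)
    then show ?thesis by simp
  qed simp
  then have "beta_mean a b (\<lambda>t. t ^ i) =
      integral {0..1} (\<lambda>t. 1 / Beta a b * (t powr (a + real i - 1) * (1 - t) powr (b - 1)))"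
    unfolding beta_mean_def by (intro integral_cong)
  also have "\<dots> = 1 / Beta a b * Beta (a + real i) b"
    using has_integral_Beta_real[of "a + real i" b] assms
    by (simp add: integral_unique)
  also have "\<dots> = pochhammer a i / pochhammer (a + b) i"
    using Beta_real_pos[OF assms] by (simp add: Beta_add_nat[OF assms])
  finally show ?thesis .
qed

section \<open>Moments of the Bernstein weights\<close>

text \<open>These are the factorial moments of the binomial distribution. The product of (n choose
  k) and (k choose j) equals (n choose j) times (n - j choose k - j), so x^j splits off and the
  Bernstein polynomials of degree n - j sum to 1. For j > n both sides vanish.\<close>

lemma sum_choose_Bernstein:
  "(\<Sum>k\<le>n. real (k choose j) * Bernstein n k x) = real (n choose j) * x ^ j"
proof (cases "j \<le> n")
  case True
  have "(\<Sum>k\<le>n. real (k choose j) * Bernstein n k x) =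
      (\<Sum>k=0 + j..n - j + j. real (k choose j) * Bernstein n k x)"
    by (rule sum.mono_neutral_right) (use True in auto)
  also have "\<dots> = (\<Sum>k=0..n - j. real ((k + j) choose j) * Bernstein n (k + j) x)"
    by (rule sum.shift_bounds_cl_nat_ivl)
  also have "\<dots> = (\<Sum>k\<le>n - j. real (n choose j) * x ^ j * Bernstein (n - j) k x)"
  proof (rule sum.cong)
    fix k assume "k \<in> {..n - j}"
    then have "(n choose (k + j)) * ((k + j) choose j) = (n choose j) * ((n - j) choose k)"
      using choose_mult[of j "k + j" n] True by simp
    then have *: "real (n choose (k + j)) * real ((k + j) choose j) =
        real (n choose j) * real ((n - j) choose k)"
      by (metis of_nat_mult)
    have "real ((k + j) choose j) * Bernstein n (k + j) x =
        (real (n choose (k + j)) * real ((k + j) choose j)) * (x ^ (k + j) * (1 - x) ^ (n - (k + j)))"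
      by (simp add: Bernstein_def)
    then show "real ((k + j) choose j) * Bernstein n (k + j) x =
        real (n choose j) * x ^ j * Bernstein (n - j) k x"
      unfolding * by (simp add: Bernstein_def power_add add.commute)
  qed auto
  also have "\<dots> = real (n choose j) * x ^ j"
    by (simp flip: sum_distrib_left)
  finally show ?thesis .
next
  case False
  then show ?thesis
    by (auto intro!: sum.neutral simp: binomial_eq_0)
qed

text \<open>The coefficients are j! times the Stirling numbers of the second kind. Powers thus
  reduce to the binomial coefficients whose Bernstein sums are known.\<close>

lemma power_eq_choose:
  fixes k :: nat
  shows "real k ^ 2 = 2 * real (k choose 2) + real k"
    and "real k ^ 3 = 6 * real (k choose 3) + 6 * real (k choose 2) + real k"
    and "real k ^ 4 = 24 * real (k choose 4) + 36 * real (k choose 3) + 14 * real (k choose 2) + real k"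
    and "real (k choose 2) = real k * (real k - 1) / 2"
    and "real (k choose 3) = real k * (real k - 1) * (real k - 2) / 6"
    and "real (k choose 4) = real k * (real k - 1) * (real k - 2) * (real k - 3) / 24"
  by (simp_all add: binomial_gbinomial gbinomial_prod_rev numeral_eq_Suc fact_Suc field_simps)

lemma sum_power_Bernstein:
  shows "(\<Sum>k\<le>n. real k ^ 2 * Bernstein n k x) = real n * (real n - 1) * x ^ 2 + real n * x"
    and "(\<Sum>k\<le>n. real k ^ 3 * Bernstein n k x) =
      real n * (real n - 1) * (real n - 2) * x ^ 3 + 3 * real n * (real n - 1) * x ^ 2 + real n * x"
    and "(\<Sum>k\<le>n. real k ^ 4 * Bernstein n k x) =
      real n * (real n - 1) * (real n - 2) * (real n - 3) * x ^ 4
      + 6 * real n * (real n - 1) * (real n - 2) * x ^ 3 + 7 * real n * (real n - 1) * x ^ 2 + real n * x"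
  unfolding power_eq_choose(1-3) distrib_right sum.distrib mult.assoc sum_distrib_left[symmetric]
    sum_choose_Bernstein sum_k_Bernstein
  by (simp_all add: power_eq_choose(4-6))

section \<open>\<open>U\<close> as a positive linear operator, its raw and central moments\<close>

lemma U_eq:
  "x \<in> {0..1} \<Longrightarrow> U \<rho> n f x = f 0 * (1 - x) ^ n + f 1 * x ^ n +
    (\<Sum>k = 1..n - 1. beta_mean (real k * \<rho>) (real (n - k) * \<rho>) f * Bernstein n k x)"
  by (simp add: U_def beta_mean_def)

lemma U_linear:
  assumes "0 < \<rho>" "continuous_on {0..1} f" "continuous_on {0..1} g" "x \<in> {0..1}"
  shows "U \<rho> n (\<lambda>t. c * f t + d * g t) x = c * U \<rho> n f x + d * U \<rho> n g x"
proof -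
  have "(\<Sum>k = 1..n - 1. beta_mean (real k * \<rho>) (real (n - k) * \<rho>) (\<lambda>t. c * f t + d * g t) * Bernstein n k x)
      = (\<Sum>k = 1..n - 1. c * (beta_mean (real k * \<rho>) (real (n - k) * \<rho>) f * Bernstein n k x)
        + d * (beta_mean (real k * \<rho>) (real (n - k) * \<rho>) g * Bernstein n k x))"
    by (rule sum.cong) (use assms in \<open>auto simp: beta_mean_linear algebra_simps\<close>)
  then show ?thesis
    using assms(4) by (simp add: U_eq sum.distrib algebra_simps sum_distrib_left)
qed

lemma U_mono:
  assumes "0 < \<rho>" "continuous_on {0..1} f" "continuous_on {0..1} g" "x \<in> {0..1}"
    and le: "\<And>t. t \<in> {0..1} \<Longrightarrow> f t \<le> g t"
  shows "U \<rho> n f x \<le> U \<rho> n g x"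
  unfolding U_eq[OF assms(4)]
  by (intro add_mono mult_right_mono sum_mono beta_mean_mono le Bernstein_nonneg)
    (use assms in auto)

lemma U_cong:
  assumes "\<And>t. t \<in> {0..1} \<Longrightarrow> f t = g t"
  shows "U \<rho> n f = U \<rho> n g"
proof -
  have "beta_mean a b f = beta_mean a b g" for a b
    unfolding beta_mean_def by (rule integral_cong) (simp add: assms)
  moreover have "f 0 = g 0" "f 1 = g 1"
    by (simp_all add: assms)
  ultimately show ?thesis
    unfolding U_def beta_mean_def[symmetric] by presburger
qed

text \<open>The end point terms fit the pattern of the inner ones: the rising factorial of 0 is 0^i,
  and for k = n the quotient is 1. Since the two Beta parameters always add up to n\<rho>, the
  denominator does not depend on k.\<close>

lemma U_power:
  assumes "0 < \<rho>" "1 \<le> n" "x \<in> {0..1}"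
  shows "U \<rho> n (\<lambda>t. t ^ i) x =
    (\<Sum>k\<le>n. pochhammer (real k * \<rho>) i * Bernstein n k x) / pochhammer (real n * \<rho>) i"
proof -
  let ?F = "\<lambda>k. pochhammer (real k * \<rho>) i * Bernstein n k x / pochhammer (real n * \<rho>) i"
  have pos: "pochhammer (real n * \<rho>) i > 0"
    using assms by (simp add: pochhammer_pos)
  have "(\<Sum>k\<le>n. pochhammer (real k * \<rho>) i * Bernstein n k x) / pochhammer (real n * \<rho>) i
      = (\<Sum>k\<le>n. ?F k)"
    by (simp add: sum_divide_distrib)
  also have "\<dots> = ?F 0 + ?F n + (\<Sum>k = 1..n - 1. ?F k)"
  proof -
    have "{..n} = insert 0 (insert n {1..n - 1})"
      using assms by auto
    then show ?thesis
      using assms by (simp add: sum.insert)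
  qed
  also have "?F 0 = 0 ^ i * (1 - x) ^ n"
    using pos by (cases i) (auto simp: Bernstein_def pochhammer_rec)
  also have "?F n = 1 ^ i * x ^ n"
    using pos by (simp add: Bernstein_def)
  also have "(\<Sum>k = 1..n - 1. ?F k) =
      (\<Sum>k = 1..n - 1. beta_mean (real k * \<rho>) (real (n - k) * \<rho>) (\<lambda>t. t ^ i) * Bernstein n k x)"
  proof (rule sum.cong)
    fix k assume "k \<in> {1..n - 1}"
    then have k: "0 < k" "k < n" by auto
    then have "real k * \<rho> + real (n - k) * \<rho> = real n * \<rho>"
      by (simp add: of_nat_diff algebra_simps)
    then show "?F k = beta_mean (real k * \<rho>) (real (n - k) * \<rho>) (\<lambda>t. t ^ i) * Bernstein n k x"
      using k assms by (simp add: beta_mean_power)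
  qed auto
  finally show ?thesis
    by (simp add: U_eq[OF assms(3)])
qed

lemma U_low_powers:
  assumes "0 < \<rho>" "1 \<le> n" and x: "x \<in> {0..1}"
  defines "N \<equiv> real n * \<rho>"
  shows "U \<rho> n (\<lambda>t. 1) x = 1"
    and "U \<rho> n (\<lambda>t. t) x = x"
    and "U \<rho> n (\<lambda>t. t ^ 2) x = ((N - \<rho>) * x ^ 2 + (\<rho> + 1) * x) / (N + 1)"
    and "U \<rho> n (\<lambda>t. t ^ 3) x =
      ((N - \<rho>) * (N - 2 * \<rho>) * x ^ 3 + 3 * (N - \<rho>) * (\<rho> + 1) * x ^ 2 + (\<rho> + 1) * (\<rho> + 2) * x)
      / ((N + 1) * (N + 2))"
    and "U \<rho> n (\<lambda>t. t ^ 4) x =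
      ((N - \<rho>) * (N - 2 * \<rho>) * (N - 3 * \<rho>) * x ^ 4 + 6 * (N - \<rho>) * (N - 2 * \<rho>) * (\<rho> + 1) * x ^ 3
        + (N - \<rho>) * (\<rho> + 1) * (7 * \<rho> + 11) * x ^ 2 + (\<rho> + 1) * (\<rho> + 2) * (\<rho> + 3) * x)
      / ((N + 1) * (N + 2) * (N + 3))"
proof -
  \<comment> \<open>Writing n as N / \<rho> turns the weighted Bernstein sums into polynomials in N,
    \<rho> and x with a factor N, which cancels the first factor of
    \<open>pochhammer N i\<close>.\<close>
  have N: "N > 0" and n: "real n = N / \<rho>"
    using assms by auto
  have poch: "pochhammer y 2 = y ^ 2 + y" "pochhammer y 3 = y ^ 3 + 3 * y ^ 2 + 2 * y"
    "pochhammer y 4 = y ^ 4 + 6 * y ^ 3 + 11 * y ^ 2 + 6 * y" for y :: real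
    by (simp_all add: numeral_eq_Suc pochhammer_Suc algebra_simps)
  have pochN: "pochhammer N 2 = N * (N + 1)" "pochhammer N 3 = N * ((N + 1) * (N + 2))"
    "pochhammer N 4 = N * ((N + 1) * (N + 2) * (N + 3))"
    by (simp_all add: numeral_eq_Suc pochhammer_Suc algebra_simps)
  note U = U_power[OF assms(1,2) x, folded N_def]
  show "U \<rho> n (\<lambda>t. 1) x = 1"
    using U[of 0] by simp
  have "(\<Sum>k\<le>n. real k * \<rho> * Bernstein n k x) = \<rho> * (\<Sum>k\<le>n. real k * Bernstein n k x)"
    by (simp add: sum_distrib_left mult_ac del: sum_k_Bernstein)
  then show "U \<rho> n (\<lambda>t. t) x = x"
    using U[of 1] assms(1,2) by (simp add: N_def field_simps)
  have "(\<Sum>k\<le>n. pochhammer (real k * \<rho>) 2 * Bernstein n k x) =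
      \<rho> ^ 2 * (\<Sum>k\<le>n. real k ^ 2 * Bernstein n k x) + \<rho> * (\<Sum>k\<le>n. real k * Bernstein n k x)"
    unfolding poch by (simp add: power_mult_distrib algebra_simps sum.distrib sum_distrib_left del: sum_k_Bernstein)
  also have "\<dots> = N * ((N - \<rho>) * x ^ 2 + (\<rho> + 1) * x)"
    unfolding sum_power_Bernstein sum_k_Bernstein n using \<open>0 < \<rho>\<close>
    by (simp add: field_simps power2_eq_square)
  finally show "U \<rho> n (\<lambda>t. t ^ 2) x = ((N - \<rho>) * x ^ 2 + (\<rho> + 1) * x) / (N + 1)"
    using U[of 2] N by (simp add: pochN)
  have "(\<Sum>k\<le>n. pochhammer (real k * \<rho>) 3 * Bernstein n k x) =
      \<rho> ^ 3 * (\<Sum>k\<le>n. real k ^ 3 * Bernstein n k x)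
      + 3 * \<rho> ^ 2 * (\<Sum>k\<le>n. real k ^ 2 * Bernstein n k x)
      + 2 * \<rho> * (\<Sum>k\<le>n. real k * Bernstein n k x)"
    unfolding poch by (simp add: power_mult_distrib algebra_simps sum.distrib sum_distrib_left del: sum_k_Bernstein)
  also have "\<dots> = N * ((N - \<rho>) * (N - 2 * \<rho>) * x ^ 3 + 3 * (N - \<rho>) * (\<rho> + 1) * x ^ 2
      + (\<rho> + 1) * (\<rho> + 2) * x)"
    unfolding sum_power_Bernstein sum_k_Bernstein n using \<open>0 < \<rho>\<close>
    by (simp add: field_simps power_numeral_reduce)
  finally show "U \<rho> n (\<lambda>t. t ^ 3) x =
      ((N - \<rho>) * (N - 2 * \<rho>) * x ^ 3 + 3 * (N - \<rho>) * (\<rho> + 1) * x ^ 2 + (\<rho> + 1) * (\<rho> + 2) * x)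
      / ((N + 1) * (N + 2))"
    using U[of 3] N by (simp add: pochN)
  have "(\<Sum>k\<le>n. pochhammer (real k * \<rho>) 4 * Bernstein n k x) =
      \<rho> ^ 4 * (\<Sum>k\<le>n. real k ^ 4 * Bernstein n k x)
      + 6 * \<rho> ^ 3 * (\<Sum>k\<le>n. real k ^ 3 * Bernstein n k x)
      + 11 * \<rho> ^ 2 * (\<Sum>k\<le>n. real k ^ 2 * Bernstein n k x)
      + 6 * \<rho> * (\<Sum>k\<le>n. real k * Bernstein n k x)"
    unfolding poch by (simp add: power_mult_distrib algebra_simps sum.distrib sum_distrib_left del: sum_k_Bernstein)
  also have "\<dots> = N * ((N - \<rho>) * (N - 2 * \<rho>) * (N - 3 * \<rho>) * x ^ 4
      + 6 * (N - \<rho>) * (N - 2 * \<rho>) * (\<rho> + 1) * x ^ 3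
      + (N - \<rho>) * (\<rho> + 1) * (7 * \<rho> + 11) * x ^ 2 + (\<rho> + 1) * (\<rho> + 2) * (\<rho> + 3) * x)"
    unfolding sum_power_Bernstein sum_k_Bernstein n using \<open>0 < \<rho>\<close>
    by (simp add: field_simps power_numeral_reduce)
  finally show "U \<rho> n (\<lambda>t. t ^ 4) x =
      ((N - \<rho>) * (N - 2 * \<rho>) * (N - 3 * \<rho>) * x ^ 4 + 6 * (N - \<rho>) * (N - 2 * \<rho>) * (\<rho> + 1) * x ^ 3
        + (N - \<rho>) * (\<rho> + 1) * (7 * \<rho> + 11) * x ^ 2 + (\<rho> + 1) * (\<rho> + 2) * (\<rho> + 3) * x)
      / ((N + 1) * (N + 2) * (N + 3))"
    using U[of 4] N by (simp add: pochN)
qed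

lemma U_add:
  assumes "0 < \<rho>" "continuous_on {0..1} f" "continuous_on {0..1} g" "x \<in> {0..1}"
  shows "U \<rho> n (\<lambda>t. f t + g t) x = U \<rho> n f x + U \<rho> n g x"
  using U_linear[OF assms, of n 1 1] by simp

lemma U_scale:
  assumes "0 < \<rho>" "continuous_on {0..1} f" "x \<in> {0..1}"
  shows "U \<rho> n (\<lambda>t. c * f t) x = c * U \<rho> n f x"
  using U_linear[OF assms(1,2,2,3), of n c 0] by simp

text \<open>Binomial expansion of (t - x)^i with x held fixed, then linearity and the raw moments.
  The common factor \<Psi> is what makes all later bounds proportional to \<Psi>.\<close>

lemma U_central_moments:
  assumes "0 < \<rho>" "1 \<le> n" and x: "x \<in> {0..1}"
  defines "N \<equiv> real n * \<rho>"
  shows "U \<rho> n (\<lambda>t. t - x) x = 0"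
    and "U \<rho> n (\<lambda>t. (t - x) ^ 2) x = (\<rho> + 1) * Psi x / (N + 1)"
    and "U \<rho> n (\<lambda>t. (t - x) ^ 3) x =
      (\<rho> + 1) * (\<rho> + 2) * (1 - 2 * x) * Psi x / ((N + 1) * (N + 2))"
    and "U \<rho> n (\<lambda>t. (t - x) ^ 4) x =
      (\<rho> + 1) * ((3 * N * (\<rho> + 1) - 6 * (\<rho> ^ 2 + 3 * \<rho> + 3)) * Psi x + (\<rho> + 2) * (\<rho> + 3)) * Psi x
      / ((N + 1) * (N + 2) * (N + 3))"
proof -
  have N: "N > 0"
    using assms by auto
  note low = U_low_powers[OF assms(1,2) x, folded N_def]
  note U = U_add[OF assms(1) _ _ x] U_scale[OF assms(1) _ x]
  \<comment> \<open>For the fourth moment the denominators N + 1, N + 2, N + 3 are cleared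
    abstractly, with opaque numerators a, b, c, so that only a polynomial identity is left to
    expand.\<close>
  have common_denominator: "a / (p * q * r) + (s * (b / (p * q)) + (u * (c / p) + d)) = e / (p * q * r)"
    if "a + (s * (b * r) + (u * (c * (q * r)) + d * (p * q * r))) = e" "p \<noteq> 0" "q \<noteq> 0" "r \<noteq> 0"
    for a b c d e p q r s u :: real
    using that(2-) unfolding that(1)[symmetric] by (simp add: field_simps)
  have "U \<rho> n (\<lambda>t. t - x) x = U \<rho> n (\<lambda>t. t + - x * 1) x"
    by simp
  also have "\<dots> = U \<rho> n (\<lambda>t. t) x + - x * U \<rho> n (\<lambda>t. 1) x"
    by (subst U, (intro continuous_intros)+)+ (rule refl)
  finally show "U \<rho> n (\<lambda>t. t - x) x = 0"
    by (simp add: low(1,2))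
  have "U \<rho> n (\<lambda>t. (t - x) ^ 2) x =
      U \<rho> n (\<lambda>t. t ^ 2 + (- 2 * x * t + x ^ 2 * 1)) x"
    by (rule arg_cong[of _ _ "\<lambda>f. U \<rho> n f x"]) (auto simp: power_numeral_reduce algebra_simps)
  also have "\<dots> = U \<rho> n (\<lambda>t. t ^ 2) x
      + (- 2 * x * U \<rho> n (\<lambda>t. t) x + x ^ 2 * U \<rho> n (\<lambda>t. 1) x)"
    by (subst U, (intro continuous_intros)+)+ (rule refl)
  also have "\<dots> = (\<rho> + 1) * Psi x / (N + 1)"
    unfolding low using N by (simp add: Psi_def field_simps power_numeral_reduce)
  finally show "U \<rho> n (\<lambda>t. (t - x) ^ 2) x = (\<rho> + 1) * Psi x / (N + 1)" .
  have "U \<rho> n (\<lambda>t. (t - x) ^ 3) x =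
      U \<rho> n (\<lambda>t. t ^ 3 + (- 3 * x * t ^ 2 + (3 * x ^ 2 * t + - (x ^ 3) * 1))) x"
    by (rule arg_cong[of _ _ "\<lambda>f. U \<rho> n f x"]) (auto simp: power_numeral_reduce algebra_simps)
  also have "\<dots> = U \<rho> n (\<lambda>t. t ^ 3) x + (- 3 * x * U \<rho> n (\<lambda>t. t ^ 2) x
      + (3 * x ^ 2 * U \<rho> n (\<lambda>t. t) x + - (x ^ 3) * U \<rho> n (\<lambda>t. 1) x))"
    by (subst U, (intro continuous_intros)+)+ (rule refl)
  also have "\<dots> = (\<rho> + 1) * (\<rho> + 2) * (1 - 2 * x) * Psi x / ((N + 1) * (N + 2))"
    unfolding low using N by (simp add: Psi_def divide_simps, simp add: algebra_simps power_numeral_reduce)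
  finally show "U \<rho> n (\<lambda>t. (t - x) ^ 3) x =
      (\<rho> + 1) * (\<rho> + 2) * (1 - 2 * x) * Psi x / ((N + 1) * (N + 2))" .
  have "U \<rho> n (\<lambda>t. (t - x) ^ 4) x =
      U \<rho> n (\<lambda>t. t ^ 4 + (- 4 * x * t ^ 3 + (6 * x ^ 2 * t ^ 2 + (- 4 * x ^ 3 * t + x ^ 4 * 1)))) x"
    by (rule arg_cong[of _ _ "\<lambda>f. U \<rho> n f x"]) (auto simp: power_numeral_reduce algebra_simps)
  also have "\<dots> = U \<rho> n (\<lambda>t. t ^ 4) x + (- 4 * x * U \<rho> n (\<lambda>t. t ^ 3) x
      + (6 * x ^ 2 * U \<rho> n (\<lambda>t. t ^ 2) x
        + (- 4 * x ^ 3 * U \<rho> n (\<lambda>t. t) x + x ^ 4 * U \<rho> n (\<lambda>t. 1) x)))"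
    by (subst U, (intro continuous_intros)+)+ (rule refl)
  also have "\<dots> =
      (\<rho> + 1) * ((3 * N * (\<rho> + 1) - 6 * (\<rho> ^ 2 + 3 * \<rho> + 3)) * Psi x + (\<rho> + 2) * (\<rho> + 3)) * Psi x
      / ((N + 1) * (N + 2) * (N + 3))"
    unfolding low
    by (rule common_denominator)
      (use N in \<open>simp_all add: Psi_def power_numeral_reduce algebra_simps\<close>)
  finally show "U \<rho> n (\<lambda>t. (t - x) ^ 4) x =
      (\<rho> + 1) * ((3 * N * (\<rho> + 1) - 6 * (\<rho> ^ 2 + 3 * \<rho> + 3)) * Psi x + (\<rho> + 2) * (\<rho> + 3)) * Psi x
      / ((N + 1) * (N + 2) * (N + 3))" .
qed

subsection \<open>The space \<open>C0\<close> and the series of iterates\<close>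

lemma Psi_nonneg: "x \<in> {0..1} \<Longrightarrow> 0 \<le> Psi x"
  by (simp add: Psi_def)

lemma Psi_pos: "x \<in> {0<..<1} \<Longrightarrow> 0 < Psi x"
  by (simp add: Psi_def)

lemma continuous_on_Psi: "continuous_on S Psi"
  unfolding Psi_def by (intro continuous_intros)

lemma continuous_on_restrict_iff:
  "continuous_on S (restrict f S) \<longleftrightarrow> continuous_on S f"
  by (rule continuous_on_cong) auto

lemma times_Psi_in_C0:
  assumes "continuous_on {0..1} h"
  shows "times_Psi h \<in> C0"
proof -
  have "restrict h {0..1} \<in> C01"
    using assms unfolding C01_def by (auto simp only: mem_Collect_eq continuous_on_restrict_iff restrict_extensional)
  moreover have "times_Psi h = times_Psi (restrict h {0..1})"
    by (auto simp: times_Psi_def)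
  ultimately show ?thesis
    unfolding C0_def by blast
qed

lemma C0_E:
  assumes "f \<in> C0"
  obtains h where "h \<in> C01" "continuous_on {0..1} h" "f = times_Psi h"
  using assms by (auto simp: C0_def C01_def)

lemma
  assumes "f \<in> C0"
  shows C0_continuous: "continuous_on {0..1} f"
    and C0_extensional: "f \<in> extensional {0..1}"
    and C0_at_0: "f 0 = 0" and C0_at_1: "f 1 = 0"
proof -
  obtain h where h: "continuous_on {0..1} h" "f = times_Psi h"
    using assms by (rule C0_E)
  have "continuous_on {0..1} (\<lambda>x. Psi x * h x)"
    by (intro continuous_intros continuous_on_Psi h)
  then show "continuous_on {0..1} f"
    unfolding h(2) times_Psi_def continuous_on_restrict_iff .
  show "f \<in> extensional {0..1}" "f 0 = 0" "f 1 = 0"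
    by (simp_all add: h times_Psi_def Psi_def)
qed

lemma C0_linear:
  assumes "f \<in> C0" "g \<in> C0"
  shows "(\<lambda>x\<in>{0..1}. a * f x + b * g x) \<in> C0"
proof -
  obtain h k where h: "continuous_on {0..1} h" "f = times_Psi h"
    and k: "continuous_on {0..1} k" "g = times_Psi k"
    using assms by (metis C0_E)
  have "times_Psi (\<lambda>x. a * h x + b * k x) \<in> C0"
    by (intro times_Psi_in_C0 continuous_intros h k)
  also have "times_Psi (\<lambda>x. a * h x + b * k x) = (\<lambda>x\<in>{0..1}. a * f x + b * g x)"
    by (auto simp: h k times_Psi_def algebra_simps)
  finally show ?thesis .
qed

lemma C0_linear_combinationI:
  assumes "f \<in> C0" "g \<in> C0" "\<And>x. x \<in> {0..1} \<Longrightarrow> k x = a * f x + b * g x"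
  shows "restrict k {0..1} \<in> C0"
proof -
  have "restrict k {0..1} = (\<lambda>x\<in>{0..1}. a * f x + b * g x)"
    using assms(3) by (rule restrict_ext)
  then show ?thesis
    using C0_linear[OF assms(1,2)] by simp
qed

lemma C0_sum:
  fixes N :: nat
  assumes "\<And>k. f k \<in> C0"
  shows "(\<lambda>x\<in>{0..1}. \<Sum>k<N. f k x) \<in> C0"
proof (induction N)
  case 0
  show ?case
    using times_Psi_in_C0[of "\<lambda>_. 0"] by (simp add: times_Psi_def del: restrict_apply)
next
  case (Suc N)
  show ?case
    by (rule C0_linear_combinationI[OF Suc assms[of N], where a = 1 and b = 1]) simp
qed

text \<open>At the end points \<open>Psi\<close> vanishes, so the bound there comes from continuity.\<close>

lemma quotient_bound:
  assumes h: "continuous_on {0..1} h" and "\<And>x. x \<in> {0..1} \<Longrightarrow> \<bar>Psi x * h x\<bar> \<le> K * Psi x"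
    and x: "x \<in> {0..1}"
  shows "\<bar>h x\<bar> \<le> K"
proof -
  have cl: "closure {0<..<1} = {0..1 :: real}"
    by simp
  show ?thesis
  proof (rule continuous_le_on_closure[of "{0<..<1}" "\<lambda>x. \<bar>h x\<bar>" x K])
    show "continuous_on (closure {0<..<1}) (\<lambda>x. \<bar>h x\<bar>)"
      unfolding cl by (intro continuous_intros h)
    fix y :: real assume y: "y \<in> {0<..<1}"
    have "Psi y * \<bar>h y\<bar> \<le> Psi y * K"
      using assms(2)[of y] Psi_pos[OF y] y by (auto simp: abs_mult mult.commute)
    then show "\<bar>h y\<bar> \<le> K"
      using Psi_pos[OF y] by simp
  qed (use x cl in auto)
qed

text \<open>This gives the definite description in \<open>norm0\<close> its meaning. The difference
  of two quotients satisfies the hypothesis of \<open>quotient_bound\<close> with K = 0.\<close>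

lemma times_Psi_inject:
  assumes "h \<in> C01" "k \<in> C01" "times_Psi h = times_Psi k"
  shows "h = k"
proof (rule extensionalityI[of _ "{0..1}"])
  fix x :: real assume x: "x \<in> {0..1}"
  have "\<bar>h x - k x\<bar> \<le> 0"
  proof (rule quotient_bound[OF _ _ x])
    show "\<bar>Psi y * (h y - k y)\<bar> \<le> 0 * Psi y" if "y \<in> {0..1}" for y
      using fun_cong[OF assms(3), of y] that by (simp add: times_Psi_def algebra_simps)
  qed (use assms in \<open>auto simp: C01_def intro!: continuous_intros\<close>)
  then show "h x = k x" by simp
qed (use assms in \<open>auto simp: C01_def\<close>)

lemma norm0_times_Psi: "h \<in> C01 \<Longrightarrow> norm0 (times_Psi h) = sup_norm h"
  unfolding norm0_def by (rule arg_cong[of _ _ sup_norm], rule the_equality) (auto intro: times_Psi_inject)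

lemma abs_le_sup_norm:
  assumes "h \<in> C01" "x \<in> {0..1}"
  shows "\<bar>h x\<bar> \<le> sup_norm h"
  unfolding sup_norm_def
proof (rule cSUP_upper[OF assms(2)])
  have "compact ((\<lambda>x. \<bar>h x\<bar>) ` {0..1})"
    using assms by (intro compact_continuous_image continuous_intros) (auto simp: C01_def)
  then show "bdd_above ((\<lambda>x. \<bar>h x\<bar>) ` {0..1})"
    by (intro bounded_imp_bdd_above compact_imp_bounded)
qed

lemma abs_le_norm0:
  assumes "f \<in> C0" "x \<in> {0..1}"
  shows "\<bar>f x\<bar> \<le> norm0 f * Psi x"
proof -
  obtain h where h: "h \<in> C01" "f = times_Psi h"
    using assms(1) by (rule C0_E)
  then show ?thesis
    using mult_right_mono[OF abs_le_sup_norm[OF h(1) assms(2)] Psi_nonneg[OF assms(2)]] assms(2)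
      Psi_nonneg[OF assms(2)]
    by (simp add: norm0_times_Psi) (simp add: times_Psi_def abs_mult mult.commute)
qed

text \<open>Together with \<open>abs_le_norm0\<close> this makes \<open>norm0 f\<close> the least K
  for which K\<Psi> dominates f, so later arguments work with such majorants instead of
  quotients.\<close>

lemma norm0_le:
  assumes "f \<in> C0" "\<And>x. x \<in> {0..1} \<Longrightarrow> \<bar>f x\<bar> \<le> K * Psi x"
  shows "norm0 f \<le> K"
proof -
  obtain h where h: "h \<in> C01" "continuous_on {0..1} h" "f = times_Psi h"
    using assms(1) by (rule C0_E)
  have "\<bar>h x\<bar> \<le> K" if "x \<in> {0..1}" for x
    by (rule quotient_bound[OF h(2) _ that]) (use assms(2) h in \<open>auto simp: times_Psi_def\<close>)
  then have "sup_norm h \<le> K"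
    unfolding sup_norm_def by (intro cSUP_least) auto
  then show ?thesis
    using h by (simp add: norm0_times_Psi)
qed

lemma norm0_nonneg:
  assumes "f \<in> C0"
  shows "0 \<le> norm0 f"
proof -
  have "0 \<le> norm0 f * Psi (1 / 2)"
    using abs_le_norm0[OF assms, of "1 / 2"] by simp
  then show ?thesis
    by (simp add: Psi_def)
qed

section \<open>Contraction property of \<open>U\<close> on \<open>C0\<close>\<close>

text \<open>The eigenvalue of \<open>U\<close> for the eigenfunction \<Psi>, by
  \<open>U_Psi\<close>.\<close>

definition contraction_factor :: "real \<Rightarrow> nat \<Rightarrow> real" where
  "contraction_factor \<rho> n = (real n * \<rho> - \<rho>) / (real n * \<rho> + 1)"

lemma
  assumes "0 < \<rho>" "1 \<le> n"
  shows contraction_factor_nonneg: "0 \<le> contraction_factor \<rho> n"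
    and contraction_factor_less_1: "contraction_factor \<rho> n < 1"
    and one_minus_contraction_factor:
      "1 - contraction_factor \<rho> n = (\<rho> + 1) / (real n * \<rho> + 1)"
proof -
  have "0 < real n * \<rho>" "\<rho> \<le> real n * \<rho>"
    using assms by auto
  moreover from this have "0 < real n * \<rho> + 1"
    by simp
  ultimately show "0 \<le> contraction_factor \<rho> n" "contraction_factor \<rho> n < 1"
      "1 - contraction_factor \<rho> n = (\<rho> + 1) / (real n * \<rho> + 1)"
    using assms by (auto simp: contraction_factor_def field_simps)
qed

text \<open>Because f vanishes at 0 and 1, only the terms with 1 \<le> k \<le> n - 1 remain, and
  each of their Bernstein polynomials contains the factor x(1 - x). The quotient by \<Psi> is a
  polynomial.\<close>

lemma U_in_C0:
  assumes "f \<in> C0"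
  shows "U \<rho> n f \<in> C0"
proof -
  let ?b = "\<lambda>k. beta_mean (real k * \<rho>) (real (n - k) * \<rho>) f"
  let ?h = "\<lambda>x. \<Sum>k = 1..n - 1. ?b k * (real (n choose k) * x ^ (k - 1) * (1 - x) ^ (n - k - 1))"
  have "U \<rho> n f x = Psi x * ?h x" if "x \<in> {0..1}" for x
  proof -
    have "U \<rho> n f x = (\<Sum>k = 1..n - 1. ?b k * Bernstein n k x)"
      using that assms by (simp add: U_eq C0_at_0 C0_at_1)
    also have "\<dots> = Psi x * ?h x"
      unfolding sum_distrib_left
    proof (rule sum.cong)
      fix k assume "k \<in> {1..n - 1}"
      then have "Suc (k - 1) = k" "Suc (n - k - 1) = n - k"
        by auto
      then have "x ^ k = x * x ^ (k - 1)" "(1 - x) ^ (n - k) = (1 - x) * (1 - x) ^ (n - k - 1)"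
        by (metis power_Suc)+
      then show "?b k * Bernstein n k x =
          Psi x * (?b k * (real (n choose k) * x ^ (k - 1) * (1 - x) ^ (n - k - 1)))"
        by (simp add: Bernstein_def Psi_def)
    qed auto
    finally show ?thesis .
  qed
  then have "U \<rho> n f = times_Psi ?h"
    by (auto simp: times_Psi_def U_def fun_eq_iff)
  also have "\<dots> \<in> C0"
    by (intro times_Psi_in_C0 continuous_intros)
  finally show ?thesis .
qed

lemma U_Psi:
  assumes "0 < \<rho>" "1 \<le> n" "x \<in> {0..1}"
  shows "U \<rho> n Psi x = contraction_factor \<rho> n * Psi x"
proof -
  have "0 < real n * \<rho>"
    using assms by auto
  have "U \<rho> n Psi x = U \<rho> n (\<lambda>t. 1 * t + (- 1) * t ^ 2) x"
    by (rule arg_cong[of _ _ "\<lambda>f. U \<rho> n f x"]) (auto simp: Psi_def power2_eq_square algebra_simps)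
  also have "\<dots> = 1 * U \<rho> n (\<lambda>t. t) x + (- 1) * U \<rho> n (\<lambda>t. t ^ 2) x"
    by (intro U_linear continuous_intros assms)
  also have "\<dots> = contraction_factor \<rho> n * Psi x"
    unfolding U_low_powers[OF assms] contraction_factor_def using \<open>0 < real n * \<rho>\<close>
    by (simp add: Psi_def field_simps power2_eq_square)
  finally show ?thesis .
qed

lemma abs_U_le:
  assumes "0 < \<rho>" "1 \<le> n" "x \<in> {0..1}" "continuous_on {0..1} f" "continuous_on {0..1} g"
    and le: "\<And>t. t \<in> {0..1} \<Longrightarrow> \<bar>f t\<bar> \<le> g t"
  shows "\<bar>U \<rho> n f x\<bar> \<le> U \<rho> n g x"
proof -
  have "U \<rho> n f x \<le> U \<rho> n g x"
    by (intro U_mono assms) (use le in \<open>auto simp: abs_le_iff\<close>)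
  moreover have "U \<rho> n (\<lambda>t. - 1 * f t) x \<le> U \<rho> n g x"
    by (intro U_mono assms continuous_intros) (use le in \<open>auto simp: abs_le_iff\<close>)
  ultimately show ?thesis
    by (simp add: U_scale[OF assms(1,4,3), of n "- 1", simplified])
qed

text \<open>Positivity passes the bound to the image of the majorant K\<Psi>, which is an
  eigenfunction.\<close>

lemma U_contraction:
  assumes "0 < \<rho>" "1 \<le> n" "x \<in> {0..1}" "continuous_on {0..1} f"
    and le: "\<And>t. t \<in> {0..1} \<Longrightarrow> \<bar>f t\<bar> \<le> K * Psi t"
  shows "\<bar>U \<rho> n f x\<bar> \<le> K * contraction_factor \<rho> n * Psi x"
proof -
  have "\<bar>U \<rho> n f x\<bar> \<le> U \<rho> n (\<lambda>t. K * Psi t) x"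
    by (intro abs_U_le le continuous_intros continuous_on_Psi assms)
  also have "\<dots> = K * (contraction_factor \<rho> n * Psi x)"
    unfolding U_Psi[OF assms(1-3), symmetric] by (intro U_scale continuous_on_Psi assms)
  finally show ?thesis by simp
qed

lemma U_iterate_in_C0: "f \<in> C0 \<Longrightarrow> (U \<rho> n ^^ k) f \<in> C0"
  by (induction k) (auto intro: U_in_C0)

lemma U_iterate_linear:
  assumes "0 < \<rho>" "f \<in> C0" "g \<in> C0"
  shows "(U \<rho> n ^^ k) (\<lambda>x\<in>{0..1}. a * f x + b * g x)
    = (\<lambda>x\<in>{0..1}. a * (U \<rho> n ^^ k) f x + b * (U \<rho> n ^^ k) g x)"
proof (induction k)
  case (Suc k)
  let ?f = "(U \<rho> n ^^ k) f" and ?g = "(U \<rho> n ^^ k) g"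
  have "U \<rho> n (\<lambda>x\<in>{0..1}. a * ?f x + b * ?g x) = U \<rho> n (\<lambda>x. a * ?f x + b * ?g x)"
    by (rule U_cong) simp
  also have "\<dots> = (\<lambda>x\<in>{0..1}. a * U \<rho> n ?f x + b * U \<rho> n ?g x)"
  proof (rule extensionalityI[of _ "{0..1}"])
    fix x :: real assume "x \<in> {0..1}"
    then show "U \<rho> n (\<lambda>x. a * ?f x + b * ?g x) x = (\<lambda>x\<in>{0..1}. a * U \<rho> n ?f x + b * U \<rho> n ?g x) x"
      using assms by (simp add: U_linear C0_continuous U_iterate_in_C0)
  qed (auto simp: U_def)
  finally show ?case by (simp only: funpow.simps o_apply Suc)
qed simp

lemma abs_U_iterate_le:
  assumes "0 < \<rho>" "1 \<le> n" "f \<in> C0" and le: "\<And>t. t \<in> {0..1} \<Longrightarrow> \<bar>f t\<bar> \<le> K * Psi t"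
    and "x \<in> {0..1}"
  shows "\<bar>(U \<rho> n ^^ k) f x\<bar> \<le> K * contraction_factor \<rho> n ^ k * Psi x"
  using \<open>x \<in> {0..1}\<close>
proof (induction k arbitrary: x)
  case (Suc k)
  then show ?case
    using U_contraction[OF assms(1,2) Suc.prems C0_continuous[OF U_iterate_in_C0[OF assms(3)]] Suc.IH]
    by (simp add: mult_ac)
qed (simp add: le)

section \<open>The Neumann series of \<open>U\<close>\<close>

text \<open>The explicit candidate for the operator that \<open>U_power_sum\<close> describes only
  as a limit. It is extensional on \<open>C0\<close> because membership in
  \<open>linear_ops_C0\<close> demands it.\<close>

definition U_series :: "real \<Rightarrow> nat \<Rightarrow> (real \<Rightarrow> real) \<Rightarrow> real \<Rightarrow> real" where
  "U_series \<rho> n = (\<lambda>f\<in>C0. \<lambda>x\<in>{0..1}. \<Sum>k. (U \<rho> n ^^ k) f x)"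

lemma summable_U_iterates:
  assumes "0 < \<rho>" "1 \<le> n" "f \<in> C0" "x \<in> {0..1}"
  shows "summable (\<lambda>k. (U \<rho> n ^^ k) f x)"
proof (rule summable_comparison_test')
  show "summable (\<lambda>k. norm0 f * contraction_factor \<rho> n ^ k * Psi x)"
    using contraction_factor_nonneg[OF assms(1,2)] contraction_factor_less_1[OF assms(1,2)]
    by (intro summable_mult summable_mult2 summable_geometric) auto
  show "norm ((U \<rho> n ^^ k) f x) \<le> norm0 f * contraction_factor \<rho> n ^ k * Psi x" if "0 \<le> k" for k
    using abs_U_iterate_le[OF assms(1-3) abs_le_norm0 assms(4)] assms(3) by simp
qed

text \<open>Membership needs a continuous quotient by \<Psi>, so the series is summed at the level
  of the quotients: these are dominated by a geometric sequence, and the M-test makes their sum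
  continuous.\<close>

lemma U_series_in_C0:
  assumes "0 < \<rho>" "1 \<le> n" and f: "f \<in> C0"
  shows "U_series \<rho> n f \<in> C0"
proof -
  let ?q = "contraction_factor \<rho> n"
  have "\<forall>k. \<exists>h. continuous_on {0..1} h \<and> (U \<rho> n ^^ k) f = times_Psi h"
    using C0_E[OF U_iterate_in_C0[OF f]] by metis
  then obtain h where h: "\<And>k. continuous_on {0..1} (h k)"
    and U: "\<And>k. (U \<rho> n ^^ k) f = times_Psi (h k)"
    by metis
  have bound: "\<bar>h k x\<bar> \<le> norm0 f * ?q ^ k" if "x \<in> {0..1}" for k x
  proof (rule quotient_bound[OF h _ that])
    show "\<bar>Psi x * h k x\<bar> \<le> norm0 f * ?q ^ k * Psi x" if "x \<in> {0..1}" for x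
      using abs_U_iterate_le[OF assms(1,2) f abs_le_norm0[OF f] that, of k] that
      by (simp add: U times_Psi_def)
  qed
  have q: "summable (\<lambda>k. norm0 f * ?q ^ k)"
    using contraction_factor_nonneg[OF assms(1,2)] contraction_factor_less_1[OF assms(1,2)]
    by (intro summable_mult summable_geometric) auto
  have "uniform_limit {0..1} (\<lambda>N x. \<Sum>k<N. h k x) (\<lambda>x. \<Sum>k. h k x) sequentially"
    by (rule Weierstrass_m_test[OF _ q]) (simp add: bound)
  then have "continuous_on {0..1} (\<lambda>x. \<Sum>k. h k x)"
    by (rule uniform_limit_theorem[rotated])
      (auto intro!: always_eventually continuous_intros h)
  then have "times_Psi (\<lambda>x. \<Sum>k. h k x) \<in> C0"
    by (rule times_Psi_in_C0)
  also have "times_Psi (\<lambda>x. \<Sum>k. h k x) = U_series \<rho> n f"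
  proof -
    have "summable (\<lambda>k. h k x)" if "x \<in> {0..1}" for x
      by (rule summable_comparison_test'[OF q]) (use that bound in auto)
    then show ?thesis
      using f by (auto simp: U_series_def U times_Psi_def suminf_mult)
  qed
  finally show ?thesis .
qed

lemma U_series_linear:
  assumes "0 < \<rho>" "1 \<le> n" "f \<in> C0" "g \<in> C0"
  shows "U_series \<rho> n (\<lambda>x\<in>{0..1}. a * f x + b * g x) =
    (\<lambda>x\<in>{0..1}. a * U_series \<rho> n f x + b * U_series \<rho> n g x)"
proof -
  have "(\<Sum>k. a * (U \<rho> n ^^ k) f x + b * (U \<rho> n ^^ k) g x) =
      a * (\<Sum>k. (U \<rho> n ^^ k) f x) + b * (\<Sum>k. (U \<rho> n ^^ k) g x)" if "x \<in> {0..1}" for x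
    using summable_U_iterates[OF assms(1,2) _ that] assms(3,4)
    by (simp add: suminf_add[symmetric] suminf_mult summable_mult)
  moreover have "U_series \<rho> n (\<lambda>x\<in>{0..1}. a * f x + b * g x) =
      (\<lambda>x\<in>{0..1}. \<Sum>k. (U \<rho> n ^^ k) (\<lambda>x\<in>{0..1}. a * f x + b * g x) x)"
    unfolding U_series_def using C0_linear[OF assms(3,4)] by (rule restrict_apply')
  ultimately show ?thesis
    unfolding U_iterate_linear[OF assms(1,3,4)] using assms(3,4)
    by (auto simp: U_series_def)
qed

text \<open>The tail of a geometric majorant. Large N gives convergence in operator norm, while N =
  0 bounds the whole series and leads to \<open>abs_A_n_le\<close>.\<close>

lemma abs_U_series_le:
  assumes "0 < \<rho>" "1 \<le> n" "f \<in> C0" and le: "\<And>t. t \<in> {0..1} \<Longrightarrow> \<bar>f t\<bar> \<le> K * Psi t"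
    and x: "x \<in> {0..1}"
  shows "\<bar>U_series \<rho> n f x - (\<Sum>k<N. (U \<rho> n ^^ k) f x)\<bar>
    \<le> K * Psi x * contraction_factor \<rho> n ^ N / (1 - contraction_factor \<rho> n)"
proof -
  let ?q = "contraction_factor \<rho> n"
  have q: "0 \<le> ?q" "?q < 1"
    using contraction_factor_nonneg contraction_factor_less_1 assms by auto
  note summ = summable_U_iterates[OF assms(1-3) x]
  have "(\<lambda>k. K * ?q ^ N * Psi x * ?q ^ k) sums (K * ?q ^ N * Psi x * (1 / (1 - ?q)))"
    by (intro sums_mult geometric_sums) (use q in auto)
  note majorant = sums_summable[OF this] sums_unique[OF this]
  have le_term: "\<bar>(U \<rho> n ^^ (k + N)) f x\<bar> \<le> K * ?q ^ N * Psi x * ?q ^ k" for k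
    using abs_U_iterate_le[OF assms(1-3) le x, of "k + N"] by (simp add: power_add mult_ac)
  have "U_series \<rho> n f x - (\<Sum>k<N. (U \<rho> n ^^ k) f x) = (\<Sum>k. (U \<rho> n ^^ (k + N)) f x)"
    using suminf_split_initial_segment[OF summ, of N] assms(3) x by (simp add: U_series_def)
  also have "\<bar>\<dots>\<bar> \<le> (\<Sum>k. K * ?q ^ N * Psi x * ?q ^ k)"
    using norm_suminf_le[OF _ majorant(1), of "\<lambda>k. (U \<rho> n ^^ (k + N)) f x"] le_term by simp
  finally show ?thesis
    unfolding majorant(2)[symmetric] by (simp add: mult_ac)
qed

text \<open>Convergence in operator norm forces pointwise convergence, so any two limit operators
  agree on \<open>C0\<close>.\<close>

lemma limit_of_U_partial_sums:
  assumes "0 < \<rho>" and S: "S \<in> linear_ops_C0"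
    and lim: "(\<lambda>N. op_norm0 (\<lambda>f. \<lambda>x\<in>{0..1}. (\<Sum>k<N. (U \<rho> n ^^ k) f x) - S f x)) \<longlonglongrightarrow> 0"
    and f: "f \<in> C0" and x: "x \<in> {0..1}"
  shows "(\<lambda>N. \<Sum>k<N. (U \<rho> n ^^ k) f x) \<longlonglongrightarrow> S f x"
proof -
  \<comment> \<open>The operator norm sees only the unit ball, so f is scaled into it. The summand 1
    keeps c positive also for f = 0.\<close>
  define c where "c = 1 + norm0 f"
  have c: "0 < c"
    using norm0_nonneg[OF f] by (simp add: c_def)
  \<comment> \<open>The zero summand brings g into the two-term form in which linearity of S and of
    the iterates is stated.\<close>
  define g where "g = (\<lambda>x\<in>{0..1}. (1 / c) * f x + 0 * f x)"
  have g: "g \<in> C0"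
    unfolding g_def by (rule C0_linear[OF f f])
  have "norm0 g \<le> 1"
  proof (rule norm0_le[OF g])
    fix x :: real assume x: "x \<in> {0..1}"
    have "\<bar>f x\<bar> \<le> c * Psi x"
      using abs_le_norm0[OF f x] Psi_nonneg[OF x] by (simp add: c_def algebra_simps)
    then show "\<bar>g x\<bar> \<le> 1 * Psi x"
      using x c by (simp add: g_def field_simps)
  qed
  let ?d = "\<lambda>N. \<lambda>x\<in>{0..1}. (\<Sum>k<N. (U \<rho> n ^^ k) g x) - S g x"
  have S_C0: "S f \<in> C0" if "f \<in> C0" for f
    using S that by (auto simp: linear_ops_C0_def)
  have d: "?d N \<in> C0" for N
    by (rule C0_linear_combinationI[OF C0_sum[OF U_iterate_in_C0[OF g]] S_C0[OF g],
        where a = 1 and b = "- 1"]) simp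
  have "ennreal (norm0 (?d N)) \<le>
      op_norm0 (\<lambda>f. \<lambda>x\<in>{0..1}. (\<Sum>k<N. (U \<rho> n ^^ k) f x) - S f x)" for N
    unfolding op_norm0_def by (rule SUP_upper2[of g]) (use g \<open>norm0 g \<le> 1\<close> in auto)
  then have "(\<lambda>N. ennreal (norm0 (?d N))) \<longlonglongrightarrow> 0"
    by (intro tendsto_sandwich[OF _ _ tendsto_const lim]) (auto intro: always_eventually)
  then have "(\<lambda>N. ennreal (norm0 (?d N))) \<longlonglongrightarrow> ennreal 0"
    by simp
  then have "(\<lambda>N. norm0 (?d N)) \<longlonglongrightarrow> 0"
    by (rule tendsto_ennrealD) (auto intro: always_eventually norm0_nonneg d)
  have "(\<lambda>N. ?d N x) \<longlonglongrightarrow> 0"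
  proof (rule Lim_null_comparison)
    show "(\<lambda>N. norm0 (?d N) * Psi x) \<longlonglongrightarrow> 0"
      using \<open>(\<lambda>N. norm0 (?d N)) \<longlonglongrightarrow> 0\<close> by (rule tendsto_mult_left_zero)
    show "\<forall>\<^sub>F N in sequentially. norm (?d N x) \<le> norm0 (?d N) * Psi x"
      using abs_le_norm0[OF d x] by (auto intro: always_eventually)
  qed
  then have "(\<lambda>N. c * ((\<Sum>k<N. (U \<rho> n ^^ k) g x) - S g x)) \<longlonglongrightarrow> 0"
    using x by (auto intro: tendsto_mult_right_zero)
  moreover have "c * (U \<rho> n ^^ k) g x = (U \<rho> n ^^ k) f x" for k
    unfolding g_def U_iterate_linear[OF assms(1) f f] using x c by simp
  moreover have "c * S g x = S f x"
  proof -
    have "S g = (\<lambda>x\<in>{0..1}. (1 / c) * S f x + 0 * S f x)"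
      unfolding g_def using S f by (simp only: linear_ops_C0_def mem_Collect_eq)
    then show ?thesis
      using x c by simp
  qed
  ultimately have "(\<lambda>N. (\<Sum>k<N. (U \<rho> n ^^ k) f x) - S f x) \<longlonglongrightarrow> 0"
    by (simp add: right_diff_distrib sum_distrib_left)
  then show ?thesis
    by (rule LIM_zero_cancel)
qed

text \<open>Existence: on the unit ball every f is dominated by \<Psi>, so the tails are uniformly
  at most q^N / (1 - q). Uniqueness: pointwise limits on \<open>C0\<close>, and extensionality
  outside it.\<close>

lemma U_power_sum_eq:
  assumes "0 < \<rho>" "1 \<le> n"
  shows "U_power_sum \<rho> n = U_series \<rho> n"
proof -
  let ?q = "contraction_factor \<rho> n"
  let ?T = "\<lambda>S N f. \<lambda>x\<in>{0..1}. (\<Sum>k<N. (U \<rho> n ^^ k) f x) - S f x"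
  have q: "0 \<le> ?q" "?q < 1"
    using contraction_factor_nonneg contraction_factor_less_1 assms by auto
  have lin: "U_series \<rho> n \<in> linear_ops_C0"
    unfolding linear_ops_C0_def
    using U_series_in_C0[OF assms] U_series_linear[OF assms]
    by (auto simp: U_series_def)
  have le: "op_norm0 (?T (U_series \<rho> n) N) \<le> ennreal (?q ^ N / (1 - ?q))" for N
    unfolding op_norm0_def
  proof (rule SUP_least, clarify)
    fix f assume f: "f \<in> C0" "norm0 f \<le> 1"
    have T: "?T (U_series \<rho> n) N f \<in> C0"
      by (rule C0_linear_combinationI[OF C0_sum[OF U_iterate_in_C0[OF f(1)]]
          U_series_in_C0[OF assms f(1)], where a = 1 and b = "- 1"]) simp
    have "norm0 (?T (U_series \<rho> n) N f) \<le> ?q ^ N / (1 - ?q)"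
    proof (rule norm0_le[OF T])
      fix x :: real assume x: "x \<in> {0..1}"
      have "\<bar>f t\<bar> \<le> 1 * Psi t" if "t \<in> {0..1}" for t
        using abs_le_norm0[OF f(1) that] mult_right_mono[OF f(2) Psi_nonneg[OF that]] by linarith
      from abs_U_series_le[OF assms f(1) this x, of N]
      show "\<bar>?T (U_series \<rho> n) N f x\<bar> \<le> ?q ^ N / (1 - ?q) * Psi x"
        using x by (simp add: abs_minus_commute mult.commute)
    qed
    then show "ennreal (norm0 (?T (U_series \<rho> n) N f)) \<le> ennreal (?q ^ N / (1 - ?q))"
      by (rule ennreal_leI)
  qed
  have "(\<lambda>N. ?q ^ N / (1 - ?q)) \<longlonglongrightarrow> 0 / (1 - ?q)"
    by (intro tendsto_intros LIMSEQ_power_zero) (use q in auto)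
  then have "(\<lambda>N. ennreal (?q ^ N / (1 - ?q))) \<longlonglongrightarrow> 0"
    using tendsto_ennrealI by fastforce
  then have lim: "(\<lambda>N. op_norm0 (?T (U_series \<rho> n) N)) \<longlonglongrightarrow> 0"
    by (rule tendsto_sandwich[OF _ _ tendsto_const, rotated 2]) (auto simp: le)
  show ?thesis
    unfolding U_power_sum_def
  proof (rule the_equality)
    show "U_series \<rho> n \<in> linear_ops_C0 \<and> (\<lambda>N. op_norm0 (?T (U_series \<rho> n) N)) \<longlonglongrightarrow> 0"
      using lin lim by simp
    fix S assume S: "S \<in> linear_ops_C0 \<and> (\<lambda>N. op_norm0 (?T S N)) \<longlonglongrightarrow> 0"
    show "S = U_series \<rho> n"
    proof (rule extensionalityI[of _ C0])
      show "S \<in> extensional C0" "U_series \<rho> n \<in> extensional C0"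
        using S lin by (auto simp: linear_ops_C0_def PiE_def)
      fix f assume f: "f \<in> C0"
      show "S f = U_series \<rho> n f"
      proof (rule extensionalityI[of _ "{0..1}"])
        show "S f \<in> extensional {0..1}" "U_series \<rho> n f \<in> extensional {0..1}"
          using S lin f by (auto simp: linear_ops_C0_def intro!: C0_extensional)
        fix x :: real assume x: "x \<in> {0..1}"
        show "S f x = U_series \<rho> n f x"
          using LIMSEQ_unique limit_of_U_partial_sums[OF assms(1) _ _ f x] S lin lim by blast
      qed
    qed
  qed
qed

text \<open>The series is bounded by 1 / (1 - q) = (n\<rho> + 1) / (\<rho> + 1), and the factor in
  front of \<open>A_n\<close> cancels n\<rho> + 1; the bound is therefore uniform in n.\<close>

lemma abs_A_n_le:
  assumes "0 < \<rho>" "1 \<le> n" "f \<in> C0" and le: "\<And>t. t \<in> {0..1} \<Longrightarrow> \<bar>f t\<bar> \<le> K * Psi t"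
    and x: "x \<in> {0..1}"
  shows "\<bar>A_n \<rho> n f x\<bar> \<le> \<rho> / (\<rho> + 1) * K * Psi x"
proof -
  have N: "0 < real n * \<rho> + 1"
    using assms by (simp add: add_pos_pos)
  have "\<bar>U_series \<rho> n f x\<bar> \<le> K * Psi x / ((\<rho> + 1) / (real n * \<rho> + 1))"
    using abs_U_series_le[OF assms, of 0] one_minus_contraction_factor[OF assms(1,2)] by simp
  then have "\<rho> / (real n * \<rho> + 1) * \<bar>U_series \<rho> n f x\<bar>
      \<le> \<rho> / (real n * \<rho> + 1) * (K * Psi x / ((\<rho> + 1) / (real n * \<rho> + 1)))"
    using assms(1) N by (intro mult_left_mono) auto
  also have "\<dots> = \<rho> / (\<rho> + 1) * K * Psi x"
    using N by simp
  finally show ?thesis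
    using x assms(1) N by (simp add: A_n_def U_power_sum_eq[OF assms(1,2)] abs_mult)
qed

text \<open>Applying the series to \<open>U \<rho> n f\<close> shifts it by one index, so only the
  term of index 0 survives.\<close>

lemma U_series_telescope:
  assumes "0 < \<rho>" "1 \<le> n" "f \<in> C0" "x \<in> {0..1}"
  shows "U_series \<rho> n f x - U_series \<rho> n (U \<rho> n f) x = f x"
proof -
  have "U_series \<rho> n f x = f x + (\<Sum>k. (U \<rho> n ^^ Suc k) f x)"
    using suminf_split_head[OF summable_U_iterates[OF assms]] assms
    by (simp add: U_series_def)
  also have "(\<Sum>k. (U \<rho> n ^^ Suc k) f x) = U_series \<rho> n (U \<rho> n f) x"
    using assms U_in_C0[OF assms(3)] by (simp add: U_series_def funpow_swap1)
  finally show ?thesis by simp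
qed

subsection \<open>The Voronovskaja remainder\<close>

lemma deriv01_works:
  assumes "f differentiable_on {0..1}" "t \<in> {0..1}"
  shows "(f has_real_derivative deriv01 f t) (at t within {0..1})"
  using assms unfolding deriv01_def has_real_derivative_iff_has_vector_derivative
  by (simp add: differentiable_on_def vector_derivative_works)

lemma deriv01_eq:
  assumes "(f has_real_derivative d) (at t within {0..1})" "t \<in> {0..1}"
  shows "deriv01 f t = d"
  using assms unfolding deriv01_def has_real_derivative_iff_has_vector_derivative
  by (intro vector_derivative_within_closed_interval) auto

text \<open>\<open>inv_into\<close> is meaningful only on the range, so a preimage is built by
  integrating h twice.\<close>

lemma times_Psi_in_range_A:
  assumes "0 < \<rho>" and h: "continuous_on {0..1} h"
  shows "times_Psi h \<in> A \<rho> ` dom_A"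
proof -
  define d where "d = 2 * \<rho> / (\<rho> + 1)"
  define F where "F t = integral {0..t} h" for t
  define G where "G t = integral {0..t} F" for t
  \<comment> \<open>The term x G(1) makes y vanish at 1, while G(0) = 0 by construction; d is the
    reciprocal of the coefficient (\<rho> + 1)/(2\<rho>) in \<open>A\<close>.\<close>
  define y where "y = (\<lambda>x\<in>{0..1}. d * (G x - x * G 1))"
  have F: "(F has_real_derivative h x) (at x within {0..1})" if "x \<in> {0..1}" for x
    unfolding F_def using h that by (rule integral_has_real_derivative)
  then have "continuous_on {0..1} F"
    by (rule DERIV_continuous_on)
  then have G: "(G has_real_derivative F x) (at x within {0..1})" if "x \<in> {0..1}" for x
    unfolding G_def using that by (rule integral_has_real_derivative)
  have y': "(y has_real_derivative d * (F x - G 1)) (at x within {0..1})" if "x \<in> {0..1}" for x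
  proof (rule has_field_derivative_transform_within[OF _ zero_less_one that])
    show "((\<lambda>x. d * (G x - x * G 1)) has_real_derivative d * (F x - G 1)) (at x within {0..1})"
      by (auto intro!: derivative_eq_intros G[OF that])
  qed (simp add: y_def)
  have y'': "(deriv01 y has_real_derivative d * h x) (at x within {0..1})" if "x \<in> {0..1}" for x
  proof (rule has_field_derivative_transform_within[OF _ zero_less_one that])
    show "((\<lambda>x. d * (F x - G 1)) has_real_derivative d * h x) (at x within {0..1})"
      by (auto intro!: derivative_eq_intros F[OF that])
  qed (simp add: deriv01_eq[OF y'])
  have y''_eq: "deriv01 (deriv01 y) x = d * h x" if "x \<in> {0..1}" for x
    using y''[OF that] that by (rule deriv01_eq)
  have "continuous_on {0..1} (deriv01 (deriv01 y))"
    by (subst continuous_on_cong[OF refl y''_eq]) (auto intro: continuous_intros h)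
  moreover have "y differentiable_on {0..1}" "deriv01 y differentiable_on {0..1}"
    unfolding differentiable_on_def real_differentiable_def using y' y'' by blast+
  ultimately have "y \<in> dom_A"
    by (simp add: dom_A_def C2_01_def y_def G_def)
  moreover have "A \<rho> y = times_Psi h"
    unfolding A_def times_Psi_def
    by (rule restrict_ext) (use \<open>0 < \<rho>\<close> in \<open>simp add: y''_eq d_def Psi_def\<close>)
  ultimately show ?thesis
    by (metis image_eqI)
qed

text \<open>The preimage chosen by \<open>inv_into\<close> satisfies \<open>A\<close> y = \<Psi>h.
  Inside the interval \<Psi> can be cancelled, which determines the second derivative there.\<close>

lemma A_inv_times_Psi:
  assumes "0 < \<rho>" and h: "continuous_on {0..1} h"
  shows "A_inv \<rho> (times_Psi h) \<in> dom_A"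
    and "x \<in> {0<..<1} \<Longrightarrow>
      deriv01 (deriv01 (A_inv \<rho> (times_Psi h))) x = 2 * \<rho> / (\<rho> + 1) * h x"
proof -
  let ?y = "A_inv \<rho> (times_Psi h)"
  show "?y \<in> dom_A"
    unfolding A_inv_def by (rule inv_into_into[OF times_Psi_in_range_A[OF assms]])
  have "A \<rho> ?y = times_Psi h"
    unfolding A_inv_def by (rule f_inv_into_f[OF times_Psi_in_range_A[OF assms]])
  then have eq: "A \<rho> ?y x = times_Psi h x" for x
    by simp
  show "deriv01 (deriv01 ?y) x = 2 * \<rho> / (\<rho> + 1) * h x" if x: "x \<in> {0<..<1}"
  proof -
    have "A \<rho> ?y x = (\<rho> + 1) / (2 * \<rho>) * Psi x * deriv01 (deriv01 ?y) x"
      using x by (simp add: A_def Psi_def[of x])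
    moreover have "times_Psi h x = Psi x * h x"
      using x by (simp add: times_Psi_def)
    ultimately have "Psi x * ((\<rho> + 1) / (2 * \<rho>) * deriv01 (deriv01 ?y) x) = Psi x * h x"
      using eq[of x] by (simp only: mult_ac)
    then have "(\<rho> + 1) / (2 * \<rho>) * deriv01 (deriv01 ?y) x = h x"
      using Psi_pos[OF x] by (metis less_irrefl mult_left_cancel)
    then show ?thesis
      using \<open>0 < \<rho>\<close> by (simp add: field_simps)
  qed
qed

text \<open>The quotient of f by \<Psi> extends continuously: as f vanishes at both ends, it is a
  difference quotient times a factor tending to 1 at 0 and to -1 at 1. The limits are therefore
  f'(0) and -f'(1).\<close>

lemma dom_A_subset_C0: "dom_A \<subseteq> C0"
proof
  fix f assume f: "f \<in> dom_A"
  then have D: "(f has_real_derivative deriv01 f t) (at t within {0..1})" if "t \<in> {0..1}" for t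
    using that by (intro deriv01_works) (auto simp: dom_A_def C2_01_def)
  have f01: "f 0 = 0" "f 1 = 0" and ext: "f \<in> extensional {0..1}"
    using f by (auto simp: dom_A_def C2_01_def)
  define k where
    "k x = (if x = 0 then deriv01 f 0 else if x = 1 then - deriv01 f 1 else f x / Psi x)" for x
  have "(k \<longlongrightarrow> k x) (at x within {0..1})" if x: "x \<in> {0..1}" for x
  proof -
    consider "x = 0" | "x = 1" | "x \<in> {0<..<1}"
      using x by fastforce
    then show ?thesis
    proof cases
      case 1
      have "((\<lambda>t. (f t - f 0) / (t - 0)) \<longlongrightarrow> deriv01 f 0) (at 0 within {0..1})"
        using D[of 0] by (simp add: has_field_derivative_iff)
      then have "((\<lambda>t. (f t - f 0) / (t - 0) * (1 / (1 - t))) \<longlongrightarrow> deriv01 f 0 * (1 / (1 - 0)))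
          (at 0 within {0..1})"
        by (intro tendsto_intros) auto
      then have "(k \<longlongrightarrow> deriv01 f 0 * (1 / (1 - 0))) (at 0 within {0..1})"
        by (rule Lim_transform_within[OF _ zero_less_one])
          (auto simp: k_def f01 Psi_def dist_real_def)
      then show ?thesis
        using 1 by (simp add: k_def)
    next
      case 2
      have "((\<lambda>t. (f t - f 1) / (t - 1)) \<longlongrightarrow> deriv01 f 1) (at 1 within {0..1})"
        using D[of 1] by (simp add: has_field_derivative_iff)
      then have "((\<lambda>t. (f t - f 1) / (t - 1) * (- 1 / t)) \<longlongrightarrow> deriv01 f 1 * (- 1 / 1))
          (at 1 within {0..1})"
        by (intro tendsto_intros) auto
      then have "(k \<longlongrightarrow> deriv01 f 1 * (- 1 / 1)) (at 1 within {0..1})"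
        by (rule Lim_transform_within[OF _ zero_less_one])
          (auto simp: k_def f01 Psi_def dist_real_def field_simps)
      then show ?thesis
        using 2 by (simp add: k_def)
    next
      case 3
      have "(f \<longlongrightarrow> f x) (at x within {0..1})" "(Psi \<longlongrightarrow> Psi x) (at x within {0..1})"
        using DERIV_continuous_on[OF D] continuous_on_Psi x by (auto simp: continuous_on_def)
      then have "((\<lambda>t. f t / Psi t) \<longlongrightarrow> f x / Psi x) (at x within {0..1})"
        using Psi_pos[OF 3] by (intro tendsto_intros) auto
      \<comment> \<open>The radius excludes both end points, where k is defined separately.\<close>
      then have "(k \<longlongrightarrow> f x / Psi x) (at x within {0..1})"
        by (rule Lim_transform_within[where d = "min x (1 - x)"])
          (use 3 in \<open>auto simp: k_def dist_real_def\<close>)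
      then show ?thesis
        using 3 by (simp add: k_def)
    qed
  qed
  then have "times_Psi k \<in> C0"
    by (intro times_Psi_in_C0) (simp add: continuous_on_def)
  also have "times_Psi k = f"
  proof (rule extensionalityI[OF _ ext])
    fix x :: real assume x: "x \<in> {0..1}"
    then show "times_Psi k x = f x"
      using Psi_pos[of x] f01 by (cases "x = 0 \<or> x = 1") (auto simp: times_Psi_def k_def Psi_def)
  qed (simp add: times_Psi_def)
  finally show "f \<in> C0" .
qed

text \<open>The lower bound on n\<rho> makes the coefficient of \<Psi> inside the bracket of the
  exact formula nonnegative. Then \<Psi> \<le> 1/4 may be inserted there, and the bracket is at most
  3/4 (\<rho> + 1)(N + 3), which cancels the factor N + 3.\<close>

lemma U_fourth_central_moment_le:
  assumes "0 < \<rho>" "1 \<le> n" and x: "x \<in> {0..1}" and N: "4 * \<rho> + 6 \<le> real n * \<rho>"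
  shows "U \<rho> n (\<lambda>t. (t - x) ^ 4) x
    \<le> 3 / 4 * (\<rho> + 1)\<^sup>2 * Psi x / ((real n * \<rho> + 1) * (real n * \<rho> + 2))"
proof -
  define N where "N = real n * \<rho>"
  have N: "4 * \<rho> + 6 \<le> N"
    using N by (simp add: N_def)
  have "0 < N" using N \<open>0 < \<rho>\<close> by linarith
  let ?c = "3 * N * (\<rho> + 1) - 6 * (\<rho> ^ 2 + 3 * \<rho> + 3)"
  have "(4 * \<rho> + 6) * (3 * (\<rho> + 1)) \<le> N * (3 * (\<rho> + 1))"
    using N \<open>0 < \<rho>\<close> by (intro mult_right_mono) auto
  moreover have "(4 * \<rho> + 6) * (3 * (\<rho> + 1)) = 6 * \<rho>\<^sup>2 + 12 * \<rho> + 6 * (\<rho> ^ 2 + 3 * \<rho> + 3)"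
    by (simp add: algebra_simps power2_eq_square)
  moreover have "?c = N * (3 * (\<rho> + 1)) - 6 * (\<rho> ^ 2 + 3 * \<rho> + 3)"
    by simp
  ultimately have "0 \<le> ?c"
    using \<open>0 < \<rho>\<close> zero_le_power2[of \<rho>] by linarith
  moreover have "Psi x \<le> 1 / 4"
    using zero_le_power2[of "x - 1 / 2"] by (simp add: Psi_def power2_eq_square algebra_simps)
  ultimately have "?c * Psi x \<le> ?c * (1 / 4)"
    by (intro mult_left_mono)
  moreover have "3 / 4 * (\<rho> + 1) * (N + 3) - (\<rho> + 2) * (\<rho> + 3)
      = ?c * (1 / 4) + (\<rho>\<^sup>2 / 2 + 7 / 4 * \<rho> + 3 / 4)"
    by (simp add: field_simps power2_eq_square)
  ultimately have "?c * Psi x + (\<rho> + 2) * (\<rho> + 3) \<le> 3 / 4 * (\<rho> + 1) * (N + 3)"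
    using \<open>0 < \<rho>\<close> zero_le_power2[of \<rho>] by linarith
  then have "(\<rho> + 1) * (?c * Psi x + (\<rho> + 2) * (\<rho> + 3)) * Psi x / ((N + 1) * (N + 2) * (N + 3))
      \<le> (\<rho> + 1) * (3 / 4 * (\<rho> + 1) * (N + 3)) * Psi x / ((N + 1) * (N + 2) * (N + 3))"
    using \<open>0 < \<rho>\<close> \<open>0 < N\<close> Psi_nonneg[OF x]
    by (intro divide_right_mono mult_right_mono mult_left_mono) auto
  also have "\<dots> = 3 / 4 * (\<rho> + 1)\<^sup>2 * Psi x / ((N + 1) * (N + 2))"
    using \<open>0 < N\<close> by (simp add: power2_eq_square)
  finally show ?thesis
    using U_central_moments(4)[OF assms(1-3)] by (simp add: N_def)
qed

text \<open>Near x, y is compared with its tangent plus the double antiderivative of d times the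
  approximating line. Under \<open>U\<close> the tangent reproduces y(x), the quadratic term gives
  exactly the main term, the cubic term gives the \<omega>1 part, and the error E gives the
  \<omega>2 part through moments 2 and 4.\<close>

lemma voronovskaja_estimate:
  fixes y y' h :: "real \<Rightarrow> real"
  assumes "0 < \<rho>" "1 \<le> n" and N: "4 * \<rho> + 6 \<le> real n * \<rho>"
    and h: "continuous_on {0..1} h"
    and e: "e = sqrt ((\<rho> + 2) / (real n * \<rho> + 2))"
    and y': "\<And>t. t \<in> {0..1} \<Longrightarrow> (y has_real_derivative y' t) (at t within {0..1})"
    and y'': "\<And>t. t \<in> {0..1} \<Longrightarrow> (y' has_real_derivative y'' t) (at t within {0..1})"
    and y''_eq: "\<And>t. t \<in> {0<..<1} \<Longrightarrow> y'' t = 2 * \<rho> / (\<rho> + 1) * h t"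
    and x: "x \<in> {0..1}"
  shows "\<bar>U \<rho> n y x - y x - \<rho> / (real n * \<rho> + 1) * (Psi x * h x)\<bar>
    \<le> \<rho> / (real n * \<rho> + 1) * (e * omega1 h e / 3 + 19 / 8 * omega2 h e) * Psi x"
proof -
  define d where "d = 2 * \<rho> / (\<rho> + 1)"
  define N where "N = real n * \<rho>"
  define w where "w = omega2 h e"
  have Npos: "0 < N" and N_ge: "4 * \<rho> + 6 \<le> N" and d: "0 < d"
    using N \<open>0 < \<rho>\<close> by (auto simp: N_def d_def)
  have e_pos: "0 < e" and e_sq: "e\<^sup>2 = (\<rho> + 2) / (N + 2)"
    using Npos \<open>0 < \<rho>\<close> by (auto simp: e N_def)
  \<comment> \<open>After clearing denominators this is exactly 4\<rho> + 6 \<le> N.\<close>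
  have "e\<^sup>2 \<le> (1 / 2)\<^sup>2"
    unfolding e_sq using N_ge \<open>0 < \<rho>\<close> by (simp add: field_simps power2_eq_square)
  then have e_le: "e \<le> 1 / 2"
    by (rule power2_le_imp_le) simp
  obtain m where m: "\<bar>m\<bar> \<le> omega1 h e / e"
    and approx: "\<And>s. s \<in> {0..1} \<Longrightarrow>
      \<bar>h s - h x - m * (s - x)\<bar> \<le> (2 + 3 * ((s - x) / e)\<^sup>2) * w"
    using local_linear_approximation[OF h e_pos e_le x] unfolding w_def by metis
  have w: "0 \<le> w"
    unfolding w_def using h e_pos by (intro omega2_nonneg) auto
  define E where "E t = y t - y x - y' x * (t - x)
    - (d * h x / 2 * (t - x)\<^sup>2 + d * m / 6 * (t - x) ^ 3)" for t
  have E_le: "\<bar>E t\<bar> \<le> (2 * d * w) / 2 * (t - x)\<^sup>2 + (3 * d * w / e\<^sup>2) / 12 * (t - x) ^ 4"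
    if t: "t \<in> {0..1}" for t
    unfolding E_def
  proof (rule second_order_taylor_bound[OF y' y'' _ x t])
    fix s :: real assume s: "s \<in> {0<..<1}"
    have "y'' s - d * h x - d * m * (s - x) = d * (h s - h x - m * (s - x))"
      unfolding y''_eq[OF s] d_def[symmetric] by (simp add: algebra_simps)
    then have "\<bar>y'' s - d * h x - d * m * (s - x)\<bar> = d * \<bar>h s - h x - m * (s - x)\<bar>"
      using d by (simp add: abs_mult)
    also have "\<dots> \<le> d * ((2 + 3 * ((s - x) / e)\<^sup>2) * w)"
      using approx[of s] s d by (intro mult_left_mono) auto
    finally show "\<bar>y'' s - d * h x - d * m * (s - x)\<bar> \<le> 2 * d * w + 3 * d * w / e\<^sup>2 * (s - x)\<^sup>2"
      by (simp add: power_divide algebra_simps)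
  qed
  have y_cont: "continuous_on {0..1} y"
    using y' by (rule DERIV_continuous_on)
  note mom = U_central_moments[OF assms(1,2) x, folded N_def]
  note mom4 = U_fourth_central_moment_le[OF assms(1,2) x N, folded N_def]
  \<comment> \<open>A right-nested sum of scalar multiples, so that additivity and homogeneity of
    \<open>U\<close> can peel off one summand at a time.\<close>
  have "E = (\<lambda>t. y t + (- y x * 1 + (- y' x * (t - x)
    + (- (d * h x / 2) * (t - x)\<^sup>2 + - (d * m / 6) * (t - x) ^ 3))))"
    by (auto simp: E_def)
  then have "U \<rho> n E x = U \<rho> n (\<lambda>t. y t + (- y x * 1 + (- y' x * (t - x)
    + (- (d * h x / 2) * (t - x)\<^sup>2 + - (d * m / 6) * (t - x) ^ 3)))) x"
    by simp
  also have "\<dots> = U \<rho> n y x + (- y x * U \<rho> n (\<lambda>t. 1) x + (- y' x * U \<rho> n (\<lambda>t. t - x) x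
    + (- (d * h x / 2) * U \<rho> n (\<lambda>t. (t - x)\<^sup>2) x + - (d * m / 6) * U \<rho> n (\<lambda>t. (t - x) ^ 3) x)))"
    by (subst U_add[OF assms(1) _ _ x] U_scale[OF assms(1) _ x], (intro continuous_intros y_cont)+)+
      (rule refl)
  also have "\<dots> = U \<rho> n y x - y x - \<rho> / (N + 1) * (Psi x * h x)
      - d * m / 6 * U \<rho> n (\<lambda>t. (t - x) ^ 3) x"
  proof -
    have "d * h x / 2 * ((\<rho> + 1) * Psi x / (N + 1)) = d * (\<rho> + 1) / 2 * (Psi x * h x) / (N + 1)"
      by (simp only: times_divide_eq_left times_divide_eq_right mult_ac)
    also have "d * (\<rho> + 1) / 2 = \<rho>"
      using \<open>0 < \<rho>\<close> by (simp add: d_def)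
    also have "\<rho> * (Psi x * h x) / (N + 1) = \<rho> / (N + 1) * (Psi x * h x)"
      by simp
    finally show ?thesis
      unfolding mom(1,2) U_low_powers(1)[OF assms(1,2) x] mult_minus_left by simp
  qed
  finally have UE: "U \<rho> n y x - y x - \<rho> / (N + 1) * (Psi x * h x)
      = U \<rho> n E x + d * m / 6 * U \<rho> n (\<lambda>t. (t - x) ^ 3) x"
    by simp
  \<comment> \<open>The third moment supplies (\<rho> + 2)/(N + 2) = e^2, one factor of which is
    used up by the slope bound \<omega>1/e. The constant 1/3 comes from d(\<rho> + 1)/6 =
    \<rho>/3.\<close>
  have third: "\<bar>d * m / 6 * U \<rho> n (\<lambda>t. (t - x) ^ 3) x\<bar> \<le> \<rho> / (N + 1) * (e * omega1 h e / 3) * Psi x"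
  proof -
    have "\<bar>1 - 2 * x\<bar> \<le> 1"
      using x by auto
    then have "\<bar>m\<bar> * \<bar>1 - 2 * x\<bar> \<le> omega1 h e / e * 1"
      using m by (intro mult_mono) auto
    then have *: "\<bar>m\<bar> * \<bar>1 - 2 * x\<bar> \<le> omega1 h e / e"
      by simp
    have "\<bar>d * m / 6 * U \<rho> n (\<lambda>t. (t - x) ^ 3) x\<bar>
        = \<rho> / (N + 1) * ((\<rho> + 2) / (N + 2) * (\<bar>m\<bar> * \<bar>1 - 2 * x\<bar>) / 3) * Psi x"
    proof -
      have "d * m / 6 * (U \<rho> n (\<lambda>t. (t - x) ^ 3) x)
          = (d * (\<rho> + 1) / 2) * ((\<rho> + 2) * (m * (1 - 2 * x)) / 3 * Psi x) / ((N + 1) * (N + 2))"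
      proof -
        have "d * m / 6 * ((\<rho> + 1) * (\<rho> + 2) * (1 - 2 * x) * Psi x / Q)
            = (d * (\<rho> + 1) / 2) * ((\<rho> + 2) * (m * (1 - 2 * x)) / 3 * Psi x) / Q" for Q :: real
          by simp
        then show ?thesis
          unfolding mom(3) .
      qed
      also have "d * (\<rho> + 1) / 2 = \<rho>"
        using \<open>0 < \<rho>\<close> by (simp add: d_def)
      also have "\<rho> * ((\<rho> + 2) * (m * (1 - 2 * x)) / 3 * Psi x) / ((N + 1) * (N + 2))
          = \<rho> / (N + 1) * ((\<rho> + 2) / (N + 2) * (m * (1 - 2 * x)) / 3) * Psi x"
        by (simp only: times_divide_eq_left times_divide_eq_right divide_divide_eq_left mult_ac)
      finally show ?thesis
        using Npos \<open>0 < \<rho>\<close> Psi_nonneg[OF x] by (simp add: abs_mult)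
    qed
    also have "\<dots> \<le> \<rho> / (N + 1) * ((\<rho> + 2) / (N + 2) * (omega1 h e / e) / 3) * Psi x"
      using * Npos \<open>0 < \<rho>\<close> Psi_nonneg[OF x]
      by (intro mult_right_mono mult_left_mono divide_right_mono) auto
    also have "(\<rho> + 2) / (N + 2) * (omega1 h e / e) = e * omega1 h e"
      unfolding e_sq[symmetric] using e_pos by (simp add: power2_eq_square)
    finally show ?thesis .
  qed
  have rest: "\<bar>U \<rho> n E x\<bar> \<le> \<rho> / (N + 1) * (19 / 8 * w) * Psi x"
  proof -
    have E_cont: "continuous_on {0..1} E"
      unfolding E_def by (intro continuous_intros y_cont)
    have "\<bar>U \<rho> n E x\<bar> \<le> U \<rho> n (\<lambda>t. (2 * d * w) / 2 * (t - x)\<^sup>2 + (3 * d * w / e\<^sup>2) / 12 * (t - x) ^ 4) x"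
      by (rule abs_U_le[OF assms(1,2) x E_cont _ E_le]) (intro continuous_intros)
    also have "\<dots> = (2 * d * w) / 2 * U \<rho> n (\<lambda>t. (t - x)\<^sup>2) x
        + (3 * d * w / e\<^sup>2) / 12 * U \<rho> n (\<lambda>t. (t - x) ^ 4) x"
      by (intro U_linear continuous_intros assms(1) x)
    also have "\<dots> \<le> (2 * d * w) / 2 * ((\<rho> + 1) * Psi x / (N + 1))
        + (3 * d * w / e\<^sup>2) / 12 * (3 / 4 * (\<rho> + 1)\<^sup>2 * Psi x / ((N + 1) * (N + 2)))"
      unfolding mom(2) using d w by (intro add_left_mono mult_left_mono mom4) auto
    \<comment> \<open>Dividing by e^2 cancels N + 2 from the fourth moment. Then 2 + 3/8 bounds the
      bracket, since (\<rho> + 1)/(\<rho> + 2) \<le> 1; this is the 19/8.\<close>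
    also have "\<dots> = \<rho> / (N + 1) * ((2 + 3 / 8 * ((\<rho> + 1) / (\<rho> + 2))) * w) * Psi x"
      unfolding e_sq d_def using Npos \<open>0 < \<rho>\<close>
      by (simp add: divide_simps) (simp add: algebra_simps power2_eq_square)
    also have "\<dots> \<le> \<rho> / (N + 1) * (19 / 8 * w) * Psi x"
      using Npos \<open>0 < \<rho>\<close> w Psi_nonneg[OF x]
      by (intro mult_right_mono mult_left_mono) (auto simp: field_simps)
    finally show ?thesis .
  qed
  have "\<bar>U \<rho> n y x - y x - \<rho> / (N + 1) * (Psi x * h x)\<bar>
      \<le> \<rho> / (N + 1) * (19 / 8 * w) * Psi x + \<rho> / (N + 1) * (e * omega1 h e / 3) * Psi x"
    unfolding UE using rest third by linarith
  also have "\<dots> = \<rho> / (N + 1) * (e * omega1 h e / 3 + 19 / 8 * w) * Psi x"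
    by (simp add: algebra_simps)
  finally show ?thesis
    by (simp add: N_def w_def)
qed

section \<open>From the remainder estimate to the bound for \<open>H\<close>\<close>

theorem theorem5p2:
  fixes h :: "real \<Rightarrow> real" and \<rho> \<epsilon> :: real and n :: nat
  assumes "continuous_on {0..1} h"
    and "\<rho> > 0"
    and "n \<ge> 1"
    and "real n \<ge> (4 * \<rho> + 6) / \<rho>"
    and "\<epsilon> = sqrt ((\<rho> + 2) / (real n * \<rho> + 2))"
  shows "\<forall>x\<in>{0..1}. \<bar>H \<rho> n h x\<bar> \<le> Psi x *
    (2 * \<rho> / (3 * (\<rho> + 1)) * sqrt ((\<rho> + 2) / (real n * \<rho> + 2)) * omega1 h \<epsilon>
     + 3 / 4 * (2 * \<rho> / (\<rho> + 1)
                + 2 * \<rho> / (3 * (\<rho> + 1)) * sqrt ((\<rho> + 2) / (real n * \<rho> + 2))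
                + 7 * (\<rho> + 3) / (6 * (\<rho> + 1))) * omega2 h \<epsilon>)"
proof
  fix x :: real assume x: "x \<in> {0..1}"
  note h = assms(1) and \<rho> = assms(2) and n = assms(3)
  define y where "y = A_inv \<rho> (times_Psi h)"
  \<comment> \<open>The reciprocal of the factor in \<open>A_n\<close>, so \<open>A_n\<close> is the
    series divided by r.\<close>
  define r where "r = (real n * \<rho> + 1) / \<rho>"
  have N: "4 * \<rho> + 6 \<le> real n * \<rho>"
    using assms(4) \<rho> by (simp add: field_simps)
  then have r: "0 < r"
    using \<rho> by (simp add: r_def)
  have \<epsilon>: "0 \<le> \<epsilon>"
    using \<rho> by (simp add: assms(5))
  have om: "0 \<le> omega1 h \<epsilon>" "0 \<le> omega2 h \<epsilon>"
    using omega1_nonneg[OF h \<epsilon>] omega2_nonneg[OF h \<epsilon>] .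
  have y_dom: "y \<in> dom_A"
    unfolding y_def by (rule A_inv_times_Psi(1)[OF \<rho> h])
  then have y: "y \<in> C0"
    using dom_A_subset_C0 by blast
  have Uy: "U \<rho> n y \<in> C0"
    using y by (rule U_in_C0)
  have Psih: "times_Psi h \<in> C0"
    using h by (rule times_Psi_in_C0)
  define D where "D = (\<lambda>t\<in>{0..1}. 1 * y t + (- 1) * U \<rho> n y t)"
  have D: "D \<in> C0"
    unfolding D_def by (rule C0_linear[OF y Uy])
  \<comment> \<open>The Voronovskaja remainder \<Psi>h - r(Uy - y). As the series maps D = y - Uy
    back to y, \<open>A_n\<close> sends G to \<open>A_n\<close> (\<Psi>h) + y, which is the value of
    \<open>H\<close>.\<close>
  define G where "G = (\<lambda>t\<in>{0..1}. 1 * times_Psi h t + r * D t)"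
  have G: "G \<in> C0"
    unfolding G_def by (rule C0_linear[OF Psih D])
  let ?K = "\<epsilon> * omega1 h \<epsilon> / 3 + 19 / 8 * omega2 h \<epsilon>"
  have G_le: "\<bar>G t\<bar> \<le> ?K * Psi t" if t: "t \<in> {0..1}" for t
  proof -
    have "\<bar>U \<rho> n y t - y t - \<rho> / (real n * \<rho> + 1) * (Psi t * h t)\<bar>
        \<le> \<rho> / (real n * \<rho> + 1) * ?K * Psi t"
    proof (rule voronovskaja_estimate[OF \<rho> n N h assms(5) _ _ _ t])
      show "(y has_real_derivative deriv01 y t) (at t within {0..1})"
        "(deriv01 y has_real_derivative deriv01 (deriv01 y) t) (at t within {0..1})"
        if "t \<in> {0..1}" for t
        using y_dom that by (auto simp: dom_A_def C2_01_def intro: deriv01_works)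
      show "deriv01 (deriv01 y) t = 2 * \<rho> / (\<rho> + 1) * h t" if "t \<in> {0<..<1}" for t
        unfolding y_def by (rule A_inv_times_Psi(2)[OF \<rho> h that])
    qed
    then have "\<bar>U \<rho> n y t - y t - Psi t * h t / r\<bar> \<le> ?K * Psi t / r"
      using \<rho> by (simp add: r_def field_simps)
    then have "r * \<bar>U \<rho> n y t - y t - Psi t * h t / r\<bar> \<le> ?K * Psi t"
      using r by (simp add: field_simps)
    also have "r * \<bar>U \<rho> n y t - y t - Psi t * h t / r\<bar> = \<bar>r * (U \<rho> n y t - y t - Psi t * h t / r)\<bar>"
      using r by (simp add: abs_mult)
    also have "r * (U \<rho> n y t - y t - Psi t * h t / r) = - G t"
      using r t by (simp add: G_def D_def times_Psi_def algebra_simps)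
    finally show ?thesis by simp
  qed
  have "U_series \<rho> n D x = y x"
    unfolding D_def U_series_linear[OF \<rho> n y Uy]
    using U_series_telescope[OF \<rho> n y x] x by simp
  then have "U_series \<rho> n G x = U_series \<rho> n (times_Psi h) x + r * y x"
    unfolding G_def U_series_linear[OF \<rho> n Psih D] using x by simp
  moreover have "A_n \<rho> n f x = U_series \<rho> n f x / r" for f
    using x by (simp add: A_n_def U_power_sum_eq[OF \<rho> n] r_def)
  ultimately have "A_n \<rho> n G x = A_n \<rho> n (times_Psi h) x + y x"
    using r by (simp add: add_divide_distrib)
  then have "H \<rho> n h x = A_n \<rho> n G x"
    using x by (simp add: H_def y_def)
  then have "\<bar>H \<rho> n h x\<bar> \<le> \<rho> / (\<rho> + 1) * ?K * Psi x"
    using abs_A_n_le[OF \<rho> n G G_le x] by simp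
  also have "\<dots> \<le> (2 * \<rho> / (3 * (\<rho> + 1)) * \<epsilon> * omega1 h \<epsilon>
     + 3 / 4 * (2 * \<rho> / (\<rho> + 1) + 2 * \<rho> / (3 * (\<rho> + 1)) * \<epsilon>
                + 7 * (\<rho> + 3) / (6 * (\<rho> + 1))) * omega2 h \<epsilon>) * Psi x"
  proof (rule mult_right_mono[OF _ Psi_nonneg[OF x]])
    have "\<rho> / (3 * (\<rho> + 1)) \<le> 2 * \<rho> / (3 * (\<rho> + 1))"
      using \<rho> by (intro divide_right_mono) auto
    then have 1: "\<rho> / (3 * (\<rho> + 1)) * (\<epsilon> * omega1 h \<epsilon>) \<le> 2 * \<rho> / (3 * (\<rho> + 1)) * (\<epsilon> * omega1 h \<epsilon>)"
      using \<epsilon> om by (intro mult_right_mono) auto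
    have "19 / 8 * \<rho> / (\<rho> + 1) \<le> 3 / 4 * (2 * \<rho> / (\<rho> + 1) + 7 * (\<rho> + 3) / (6 * (\<rho> + 1)))"
    proof -
      \<comment> \<open>Here 3/4 (2\<rho> + 7(\<rho> + 3)/6) = 19/8 \<rho> + 21/8: the coefficients
        of \<rho> agree and only the positive constant is dropped.\<close>
      have "19 / 8 * \<rho> / (\<rho> + 1) \<le> 3 / 4 * (2 * \<rho> + 7 * (\<rho> + 3) / 6) / (\<rho> + 1)"
        using \<rho> by (intro divide_right_mono) auto
      also have "\<dots> = 3 / 4 * (2 * \<rho> / (\<rho> + 1) + 7 * (\<rho> + 3) / (6 * (\<rho> + 1)))"
        unfolding divide_divide_eq_left[symmetric] add_divide_distrib[symmetric]
        by (rule times_divide_eq_right[symmetric])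
      finally show ?thesis .
    qed
    also have "\<dots> \<le> 3 / 4 * (2 * \<rho> / (\<rho> + 1) + 2 * \<rho> / (3 * (\<rho> + 1)) * \<epsilon>
        + 7 * (\<rho> + 3) / (6 * (\<rho> + 1)))"
      using \<rho> \<epsilon> by simp
    finally have 2: "19 / 8 * \<rho> / (\<rho> + 1) * omega2 h \<epsilon> \<le> 3 / 4 * (2 * \<rho> / (\<rho> + 1)
        + 2 * \<rho> / (3 * (\<rho> + 1)) * \<epsilon> + 7 * (\<rho> + 3) / (6 * (\<rho> + 1))) * omega2 h \<epsilon>"
      using om(2) by (rule mult_right_mono)
    have "\<rho> / (\<rho> + 1) * ?K
        = \<rho> / (3 * (\<rho> + 1)) * (\<epsilon> * omega1 h \<epsilon>) + 19 / 8 * \<rho> / (\<rho> + 1) * omega2 h \<epsilon>"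
    proof -
      define c where "c = \<rho> / (\<rho> + 1)"
      have "\<rho> / (3 * (\<rho> + 1)) = c / 3" "19 / 8 * \<rho> / (\<rho> + 1) = 19 / 8 * c"
        by (simp_all add: c_def)
      then show ?thesis
        unfolding c_def[symmetric] by (simp only: ring_distribs times_divide_eq_left times_divide_eq_right mult_ac)
    qed
    with add_mono[OF 1 2] show "\<rho> / (\<rho> + 1) * ?K \<le> 2 * \<rho> / (3 * (\<rho> + 1)) * \<epsilon> * omega1 h \<epsilon>
     + 3 / 4 * (2 * \<rho> / (\<rho> + 1) + 2 * \<rho> / (3 * (\<rho> + 1)) * \<epsilon>
                + 7 * (\<rho> + 3) / (6 * (\<rho> + 1))) * omega2 h \<epsilon>"
      by (simp only: mult.assoc)
  qed
  finally show "\<bar>H \<rho> n h x\<bar> \<le> Psi x *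
    (2 * \<rho> / (3 * (\<rho> + 1)) * sqrt ((\<rho> + 2) / (real n * \<rho> + 2)) * omega1 h \<epsilon>
     + 3 / 4 * (2 * \<rho> / (\<rho> + 1)
                + 2 * \<rho> / (3 * (\<rho> + 1)) * sqrt ((\<rho> + 2) / (real n * \<rho> + 2))
                + 7 * (\<rho> + 3) / (6 * (\<rho> + 1))) * omega2 h \<epsilon>)"
    unfolding assms(5)[symmetric] by (simp only: mult.commute)
qed

end
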